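(* The product on the space of functions $\{\mathcal F_{[w]}\mid w\in T(V^* )\}$ given by $$\mathcal F_{[w_1]}\star\mathcal F_{[w_2]}:=\mathcal F_{[w_1\otimes w_2]}\qquad(w_1,w_2\in T(V^* ))$$ is a well-defined associative product (well-defined meaning that $\mathcal F_{[w_1\otimes w_2]}$ depends only on $\mathcal F_{[w_1]}$ and $\mathcal F_{[w_2]}$).
   Context: Setting. $V$ is a complex vector space with basis $X_1,\dots,X_N$; $T=T(V)=\bigoplus_{r\ge 0}T^r$, $T^r=V^{\otimes r}$; the sign $\otimes$ is often omitted. Fix $q\in\mathbb C^*$ and, for $N\ge i>j\ge 1$, nonzero complex numbers of the form $b_{ij}=q^{\alpha_{ij}}$ and elements $p_{ij}\in\mathrm{Span}\{X_aX_b\mid 1\le a,b\le i-1\}\subset T^2$. $I_R\subset T$ is the two-sided ideal generated by all $X_iX_j-b_{ij}X_jX_i-p_{ij}$ ($i>j$), and $\mathcal A=T/I_R$. Order. For a monomial $X=X_{i_1}\cdots X_{i_r}\in T^r$ put $\ell(X)=(n_1,\dots,n_N)$, $n_i=\#\{s\mid i_s=i\}$. On $\{0,\dots,r\}^N$ use the lexicographic order $\le_l$ in which the last coordinate is most significant (so $(0,\dots,0,r)$ is the biggest). For monomials $u,u'\in T^r$, $u'\le_l u$ means $\ell(u')\le_l\ell(u)$; the order of a nonzero element of $T^r$ is the largest $\ell$ of the monomials occurring in it, and elements are compared via their orders. Standing assumption (EA): every nonzero homogeneous $u\in I_R$ lies in the span of the elements $a(X_iX_j-b_{ij}X_jX_i-p_{ij})b$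 with $i>j$, $a,b$ monomials in $T$, and $aX_iX_jb\le_l u$. Operators. $S:V\otimes V\to V\otimes V$ is the linear map with $S(X_iX_j)=b_{ij}X_jX_i+p_{ij}$ and $S(X_jX_i)=b_{ij}^{-1}(X_iX_j-p_{ij})$ for $i>j$, and $S(X_iX_i)=X_iX_i$. On $T^n$, $\sigma_i$ ($1\le i\le n-1$) is $S$ applied in tensor positions $i,i+1$. For each $\sigma\in S_n$ choose an expression $\sigma=s_{i_1}\cdots s_{i_m}$ as a product of elementary transpositions $s_j=(j\ j{+}1)$ and put $\widehat\sigma=\sigma_{i_1}\cdots\sigma_{i_m}$; put $P=\frac1{n!}\sum_{\sigma\in S_n}\widehat\sigma$ on $T^n$. Then $\mathcal P_{q\text{-sym}}=\lim_{M\to\infty}P^M$ (for each $u\in T^n$ the sequence $P^M(u)$ is eventually constant, and the limit does not depend on the choices of expressions). Duality. $V^*$ is the linear dual of $V$, and $\langle\cdot,\cdot\rangle$ is the pairing of $T(V^* )$ with $T(V)$ given by $\langle w_1\otimes\cdots\otimes w_m,z_1\otimes\cdots\otimes z_n\rangle=\delta_{m,n}\prod_i\langle w_i,z_i\rangle$. $I_R^t\subset V^*\otimes V^*$ is the kernel of the transpose of $\mathcal P_{q\text{-sym}}|_{V\otimes V}$, and $\mathcal A^t$ is the quotient of $T(V^* )$ by the two-sided ideal generated by $I_R^t$. For $w\in T(V^* )$, $z\in T$ put $\mathcal F_w(z)=\langle w,\mathcal P_{q\text{-sym}}(z)\rangle$; this depends only on the classes $[w]\in\mathcal A^t$ and $[z]\in\mathcal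 A$, and one writes $\mathcal F_w(z)=\mathcal F_{[w]}([z])$. *)

theory Defs
  imports
    Complex_Main
    "HOL-Library.Poly_Mapping"
    "HOL-Library.FuncSet"
    "HOL-Combinatorics.Permutations"
begin

alias lookup = Poly_Mapping.lookup
alias keys = Poly_Mapping.keys

subsection \<open>The tensor algebra\<close>

text \<open>
  The basis vectors \<open>X\<^sub>1, \<dots>, X\<^sub>N\<close> are indexed by a finite linearly ordered type \<open>'n\<close>
  with \<open>N\<close> elements.  A word \<open>[i\<^sub>1, \<dots>, i\<^sub>r]\<close> stands for the monomial
  \<open>X\<^bsub>i\<^sub>1\<^esub> \<otimes> \<cdots> \<otimes> X\<^bsub>i\<^sub>r\<^esub>\<close>, and \<open>T(V)\<close> is the monoid algebra of the free monoid of words.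
  With concatenation as addition of words, the convolution product that
  \<^theory>\<open>HOL-Library.Poly_Mapping\<close> puts on finitely supported functions is the tensor product.
\<close>

instantiation list :: (type) monoid_add
begin

definition zero_list :: "'a list" where "zero_list = []"

definition plus_list :: "'a list \<Rightarrow> 'a list \<Rightarrow> 'a list" where "plus_list = (@)"

instance
  by standard (simp_all add: zero_list_def plus_list_def)

end

type_synonym 'n tensor = "'n list \<Rightarrow>\<^sub>0 complex"

abbreviation mon :: "'n list \<Rightarrow> 'n tensor" where
  "mon w \<equiv> Poly_Mapping.single w 1"

definition scal :: "complex \<Rightarrow> 'n tensor \<Rightarrow> 'n tensor" where
  "scal c u = Poly_Mapping.map ((*) c) u"

lemma lookup_scal: "lookup (scal c u) w = c * lookup u w"
  by (simp add: scal_def Poly_Mapping.map.rep_eq when_def)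

interpretation tens: vector_space "scal :: complex \<Rightarrow> 'n tensor \<Rightarrow> 'n tensor"
  by standard (auto intro!: poly_mapping_eqI simp: lookup_scal lookup_add algebra_simps)

text \<open>The homogeneous component \<open>T\<^sup>r\<close> and the projection onto it.\<close>

definition Tdeg :: "nat \<Rightarrow> 'n tensor set" where
  "Tdeg r = {u. \<forall>w\<in>keys u. length w = r}"

definition hom_part :: "nat \<Rightarrow> 'n tensor \<Rightarrow> 'n tensor" where
  "hom_part r u = Poly_Mapping.mapp (\<lambda>w c. if length w = r then c else 0) u"

definition lin_ext :: "('n list \<Rightarrow> 'm tensor) \<Rightarrow> 'n tensor \<Rightarrow> 'm tensor" where
  "lin_ext f u = (\<Sum>w\<in>keys u. scal (lookup u w) (f w))"

definition two_sided_ideal :: "'a::ring_1 set \<Rightarrow> bool" where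
  "two_sided_ideal I \<longleftrightarrow>
     0 \<in> I \<and> (\<forall>x\<in>I. \<forall>y\<in>I. x + y \<in> I) \<and> (\<forall>x\<in>I. \<forall>a. a * x \<in> I \<and> x * a \<in> I)"

definition ideal_gen :: "'a::ring_1 set \<Rightarrow> 'a set" where
  "ideal_gen G = \<Inter>{I. two_sided_ideal I \<and> G \<subseteq> I}"

definition qclass :: "'a::ring_1 set \<Rightarrow> 'a \<Rightarrow> 'a set" where
  "qclass I u = {v. v - u \<in> I}"

definition quot :: "'a::ring_1 set \<Rightarrow> 'a set set" where
  "quot I = range (qclass I)"


subsection \<open>The quadratic algebra\<close>

text \<open>\<open>z\<close> is a value of the (in general multivalued) complex power \<open>q\<^sup>a\<close>.\<close>

definition is_cpower :: "complex \<Rightarrow> complex \<Rightarrow> complex \<Rightarrow> bool" where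
  "is_cpower q a z \<longleftrightarrow> (\<exists>l. exp l = q \<and> z = exp (a * l))"

definition rel :: "('n \<Rightarrow> 'n \<Rightarrow> complex) \<Rightarrow> ('n \<Rightarrow> 'n \<Rightarrow> 'n tensor) \<Rightarrow> 'n \<Rightarrow> 'n \<Rightarrow> 'n tensor" where
  "rel b p i j = mon [i, j] - scal (b i j) (mon [j, i]) - p i j"

definition I_R :: "('n::linorder \<Rightarrow> 'n \<Rightarrow> complex) \<Rightarrow> ('n \<Rightarrow> 'n \<Rightarrow> 'n tensor) \<Rightarrow> 'n tensor set" where
  "I_R b p = ideal_gen {rel b p i j | i j. j < i}"

definition A_alg :: "('n::linorder \<Rightarrow> 'n \<Rightarrow> complex) \<Rightarrow> ('n \<Rightarrow> 'n \<Rightarrow> 'n tensor) \<Rightarrow> 'n tensor set set" where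
  "A_alg b p = quot (I_R b p)"


subsection \<open>The order and the assumption (EA)\<close>

definition ell :: "'n list \<Rightarrow> 'n \<Rightarrow> nat" where
  "ell w i = count_list w i"

text \<open>Lexicographic order in which the largest index is the most significant one.\<close>

definition lex_le :: "('n::linorder \<Rightarrow> nat) \<Rightarrow> ('n \<Rightarrow> nat) \<Rightarrow> bool" where
  "lex_le f g \<longleftrightarrow> f = g \<or> (\<exists>i. f i < g i \<and> (\<forall>k>i. f k = g k))"

definition tord :: "'n::linorder tensor \<Rightarrow> 'n \<Rightarrow> nat" where
  "tord u = (THE f. f \<in> ell ` keys u \<and> (\<forall>g\<in>ell ` keys u. lex_le g f))"

definition EA :: "('n::linorder \<Rightarrow> 'n \<Rightarrow> complex) \<Rightarrow> ('n \<Rightarrow> 'n \<Rightarrow> 'n tensor) \<Rightarrow> bool" where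
  "EA b p \<longleftrightarrow> (\<forall>r. \<forall>u \<in> I_R b p \<inter> Tdeg r. u \<noteq> 0 \<longrightarrow>
     u \<in> tens.span {mon a * rel b p i j * mon c | a i j c.
           j < i \<and> length (a @ [i, j] @ c) = r \<and> lex_le (tord (mon (a @ [i, j] @ c))) (tord u)})"


subsection \<open>The operators\<close>

text \<open>\<open>S_op b p x y\<close> is \<open>S(X\<^sub>xX\<^sub>y)\<close>.\<close>

definition S_op ::
  "('n::linorder \<Rightarrow> 'n \<Rightarrow> complex) \<Rightarrow> ('n \<Rightarrow> 'n \<Rightarrow> 'n tensor) \<Rightarrow> 'n \<Rightarrow> 'n \<Rightarrow> 'n tensor" where
  "S_op b p x y =
     (if y < x then scal (b x y) (mon [y, x]) + p x y
      else if x < y then scal (inverse (b y x)) (mon [y, x] - p y x)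
      else mon [x, x])"

text \<open>Positions are counted from 1.  On words that have no letters in positions
  \<open>i, i + 1\<close> the value is irrelevant.\<close>

definition sigma_op ::
  "('n::linorder \<Rightarrow> 'n \<Rightarrow> complex) \<Rightarrow> ('n \<Rightarrow> 'n \<Rightarrow> 'n tensor) \<Rightarrow> nat \<Rightarrow> 'n tensor \<Rightarrow> 'n tensor" where
  "sigma_op b p i = lin_ext (\<lambda>w.
     if 1 \<le> i \<and> i < length w
     then mon (take (i - 1) w) * S_op b p (w ! (i - 1)) (w ! i) * mon (drop (i + 1) w)
     else mon w)"

text \<open>\<open>\<sigma> = s\<^bsub>i\<^sub>1\<^esub> \<cdots> s\<^bsub>i\<^sub>m\<^esub>\<close> with all \<open>i\<^sub>k\<close> in \<open>{1..n-1}\<close>; the expression need not be reduced.\<close>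

definition is_expression :: "nat \<Rightarrow> (nat \<Rightarrow> nat) \<Rightarrow> nat list \<Rightarrow> bool" where
  "is_expression n \<sigma> js \<longleftrightarrow>
     set js \<subseteq> {1..<n} \<and> foldr (\<lambda>j \<pi>. transpose j (Suc j) \<circ> \<pi>) js id = \<sigma>"

definition sigma_hat ::
  "('n::linorder \<Rightarrow> 'n \<Rightarrow> complex) \<Rightarrow> ('n \<Rightarrow> 'n \<Rightarrow> 'n tensor) \<Rightarrow> nat list \<Rightarrow> 'n tensor \<Rightarrow> 'n tensor" where
  "sigma_hat b p js = foldr (\<lambda>j f. sigma_op b p j \<circ> f) js id"

type_synonym expr_choice = "nat \<Rightarrow> (nat \<Rightarrow> nat) \<Rightarrow> nat list"

text \<open>\<open>ex n \<sigma>\<close> is the expression chosen for \<open>\<sigma> \<in> S\<^sub>n\<close>.\<close>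

definition P_op ::
  "('n::linorder \<Rightarrow> 'n \<Rightarrow> complex) \<Rightarrow> ('n \<Rightarrow> 'n \<Rightarrow> 'n tensor) \<Rightarrow> expr_choice \<Rightarrow>
   nat \<Rightarrow> 'n tensor \<Rightarrow> 'n tensor" where
  "P_op b p ex n u =
     scal (1 / fact n) (\<Sum>\<sigma> | \<sigma> permutes {1..n}. sigma_hat b p (ex n \<sigma>) u)"

text \<open>Coefficientwise limit, which on each finite-dimensional space \<open>T\<^sup>n\<close> is the limit in the
  usual topology.\<close>

definition tens_lim :: "(nat \<Rightarrow> 'n tensor) \<Rightarrow> 'n tensor" where
  "tens_lim U = (THE v. \<forall>w. (\<lambda>M. lookup (U M) w) \<longlonglongrightarrow> lookup v w)"

definition P_qsym ::
  "('n::linorder \<Rightarrow> 'n \<Rightarrow> complex) \<Rightarrow> ('n \<Rightarrow> 'n \<Rightarrow> 'n tensor) \<Rightarrow> expr_choice \<Rightarrow>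
   'n tensor \<Rightarrow> 'n tensor" where
  "P_qsym b p ex u =
     (\<Sum>n\<in>length ` keys u. tens_lim (\<lambda>M. (P_op b p ex n ^^ M) (hom_part n u)))"


subsection \<open>Duality\<close>

text \<open>Elements of \<open>T(V\<^sup>*)\<close> are written in the basis of words in the dual basis of
  \<open>X\<^sub>1, \<dots>, X\<^sub>N\<close>; the pairing of words is the product of the letterwise pairings.\<close>

definition word_pairing :: "'n list \<Rightarrow> 'n list \<Rightarrow> complex" where
  "word_pairing u v =
     (if length u = length v then \<Prod>k<length u. of_bool (u ! k = v ! k) else 0)"

definition pairing :: "'n tensor \<Rightarrow> 'n tensor \<Rightarrow> complex" where
  "pairing w z = (\<Sum>u\<in>keys w. \<Sum>v\<in>keys z. lookup w u * lookup z v * word_pairing u v)"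

text \<open>Kernel of the transpose of the restriction of \<open>P_qsym\<close> to \<open>V \<otimes> V\<close>.\<close>

definition I_Rt ::
  "('n::linorder \<Rightarrow> 'n \<Rightarrow> complex) \<Rightarrow> ('n \<Rightarrow> 'n \<Rightarrow> 'n tensor) \<Rightarrow> expr_choice \<Rightarrow>
   'n tensor set" where
  "I_Rt b p ex = {w \<in> Tdeg 2. \<forall>z\<in>Tdeg 2. pairing w (P_qsym b p ex z) = 0}"

definition dual_class ::
  "('n::linorder \<Rightarrow> 'n \<Rightarrow> complex) \<Rightarrow> ('n \<Rightarrow> 'n \<Rightarrow> 'n tensor) \<Rightarrow> expr_choice \<Rightarrow>
   'n tensor \<Rightarrow> 'n tensor set" where
  "dual_class b p ex = qclass (ideal_gen (I_Rt b p ex))"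

definition F_tens ::
  "('n::linorder \<Rightarrow> 'n \<Rightarrow> complex) \<Rightarrow> ('n \<Rightarrow> 'n \<Rightarrow> 'n tensor) \<Rightarrow> expr_choice \<Rightarrow>
   'n tensor \<Rightarrow> 'n tensor \<Rightarrow> complex" where
  "F_tens b p ex w z = pairing w (P_qsym b p ex z)"

text \<open>For \<open>W\<close> in the quotient of \<open>T(V\<^sup>*)\<close>, the function \<open>F\<^sub>W\<close> on the quotient of \<open>T(V)\<close>: its value
  at \<open>Z\<close> is the common value of \<open>F_tens\<close> on all representatives.\<close>

definition F_fun ::
  "('n::linorder \<Rightarrow> 'n \<Rightarrow> complex) \<Rightarrow> ('n \<Rightarrow> 'n \<Rightarrow> 'n tensor) \<Rightarrow> expr_choice \<Rightarrow>
   'n tensor set \<Rightarrow> 'n tensor set \<Rightarrow> complex" where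
  "F_fun b p ex W =
     (\<lambda>Z\<in>A_alg b p. THE c. \<forall>w\<in>W. \<forall>z\<in>Z. F_tens b p ex w z = c)"

text \<open>The function \<open>F\<^bsub>[w]\<^esub>\<close>.\<close>

definition F_br ::
  "('n::linorder \<Rightarrow> 'n \<Rightarrow> complex) \<Rightarrow> ('n \<Rightarrow> 'n \<Rightarrow> 'n tensor) \<Rightarrow> expr_choice \<Rightarrow>
   'n tensor \<Rightarrow> 'n tensor set \<Rightarrow> complex" where
  "F_br b p ex w = F_fun b p ex (dual_class b p ex w)"

definition F_space ::
  "('n::linorder \<Rightarrow> 'n \<Rightarrow> complex) \<Rightarrow> ('n \<Rightarrow> 'n \<Rightarrow> 'n tensor) \<Rightarrow> expr_choice \<Rightarrow>
   ('n tensor set \<Rightarrow> complex) set" where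
  "F_space b p ex = range (F_br b p ex)"

text \<open>The product \<open>F\<^bsub>[w\<^sub>1]\<^esub> \<star> F\<^bsub>[w\<^sub>2]\<^esub> = F\<^bsub>[w\<^sub>1 \<otimes> w\<^sub>2]\<^esub>\<close>, computed from any representatives; it is
  meaningful once the right-hand side is known not to depend on them.\<close>

definition F_star ::
  "('n::linorder \<Rightarrow> 'n \<Rightarrow> complex) \<Rightarrow> ('n \<Rightarrow> 'n \<Rightarrow> 'n tensor) \<Rightarrow> expr_choice \<Rightarrow>
   ('n tensor set \<Rightarrow> complex) \<Rightarrow> ('n tensor set \<Rightarrow> complex) \<Rightarrow> ('n tensor set \<Rightarrow> complex)" where
  "F_star b p ex f g = (THE h. \<exists>w1 w2.
     f = F_br b p ex w1 \<and>
     g = F_br b p ex w2 \<and>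
     h = F_br b p ex (w1 * w2))"


text \<open>The pairing satisfies the defining formula on products of vectors and covectors.\<close>

lemma word_pairing_eq: "word_pairing u v = of_bool (u = v)"
  by (auto simp: word_pairing_def list_eq_iff_nth_eq)

lemma pairing_eq: "pairing w z = (\<Sum>u\<in>keys w. lookup w u * lookup z u)"
proof -
  have "(\<Sum>v\<in>keys z. lookup w u * lookup z v * word_pairing u v) = lookup w u * lookup z u" for u
    by (simp add: word_pairing_eq of_bool_def if_distrib sum.delta' in_keys_iff cong: if_cong)
  then show ?thesis by (simp add: pairing_def)
qed

lemma pairing_superset:
  assumes "finite A" "keys w \<subseteq> A"
  shows "pairing w z = (\<Sum>u\<in>A. lookup w u * lookup z u)"
  unfolding pairing_eq by (rule sum.mono_neutral_left) (use assms in \<open>auto simp: in_keys_iff\<close>)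

lemma pairing_zero: "pairing 0 z = 0" "pairing w 0 = 0"
  by (simp_all add: pairing_eq)

lemma pairing_add_left: "pairing (w + w') z = pairing w z + pairing w' z"
proof -
  let ?A = "keys w \<union> keys w'"
  have "pairing (w + w') z = (\<Sum>u\<in>?A. lookup (w + w') u * lookup z u)"
    by (rule pairing_superset) (use Poly_Mapping.keys_add[of w w'] in auto)
  moreover have "pairing w z = (\<Sum>u\<in>?A. lookup w u * lookup z u)"
    by (rule pairing_superset) auto
  moreover have "pairing w' z = (\<Sum>u\<in>?A. lookup w' u * lookup z u)"
    by (rule pairing_superset) auto
  ultimately show ?thesis by (simp add: lookup_add sum.distrib algebra_simps)
qed

lemma pairing_add_right: "pairing w (z + z') = pairing w z + pairing w z'"
  by (simp add: pairing_eq lookup_add sum.distrib algebra_simps)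

lemma pairing_sum_left: "pairing (\<Sum>x\<in>A. f x) z = (\<Sum>x\<in>A. pairing (f x) z)"
  by (induction A rule: infinite_finite_induct) (simp_all add: pairing_zero pairing_add_left)

lemma pairing_sum_right: "pairing w (\<Sum>x\<in>A. f x) = (\<Sum>x\<in>A. pairing w (f x))"
  by (induction A rule: infinite_finite_induct) (simp_all add: pairing_zero pairing_add_right)

lemma pairing_single:
  "pairing (Poly_Mapping.single u c) (Poly_Mapping.single v d) = c * d * of_bool (u = v)"
  by (simp add: pairing_eq lookup_single when_def)

lemma tensor_expand: "(u :: 'n tensor) = (\<Sum>w\<in>keys u. Poly_Mapping.single w (lookup u w))"
  by (rule poly_mapping_eqI)
    (simp add: lookup_sum lookup_single when_def sum.delta' in_keys_iff)

lemma pairing_mult: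
  assumes "w \<in> Tdeg r" "z \<in> Tdeg r"
  shows "pairing (w * w') (z * z') = pairing w z * pairing w' z'"
proof -
  have prodE: "x * y = (\<Sum>u\<in>keys x. \<Sum>v\<in>keys y.
      Poly_Mapping.single (u @ v) (lookup x u * lookup y v))" for x y :: "'n tensor"
    by (subst tensor_expand[of x], subst tensor_expand[of y])
      (simp add: sum_product mult_single plus_list_def)
  have "pairing (w * w') (z * z') =
     (\<Sum>u\<in>keys w. \<Sum>u'\<in>keys w'. \<Sum>v\<in>keys z. \<Sum>v'\<in>keys z'.
        (lookup w u * lookup w' u') * (lookup z v * lookup z' v') * of_bool (u @ u' = v @ v'))"
    unfolding prodE[of w w'] prodE[of z z']
    by (simp only: pairing_sum_left) (simp only: pairing_sum_right pairing_single)
  also have "\<dots> =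
     (\<Sum>u\<in>keys w. \<Sum>u'\<in>keys w'. \<Sum>v\<in>keys z. \<Sum>v'\<in>keys z'.
        (lookup w u * lookup z v * word_pairing u v) *
        (lookup w' u' * lookup z' v' * word_pairing u' v'))"
    using assms by (intro sum.cong refl) (auto simp: Tdeg_def word_pairing_eq)
  also have "\<dots> = (\<Sum>u\<in>keys w. \<Sum>v\<in>keys z. \<Sum>u'\<in>keys w'. \<Sum>v'\<in>keys z'.
        (lookup w u * lookup z v * word_pairing u v) *
        (lookup w' u' * lookup z' v' * word_pairing u' v'))"
    by (intro sum.cong refl sum.swap)
  also have "\<dots> = pairing w z * pairing w' z'"
    by (simp only: pairing_def sum_distrib_right) (simp only: sum_distrib_left)
  finally show ?thesis .
qed

lemma Tdeg_mult: "u \<in> Tdeg r \<Longrightarrow> v \<in> Tdeg s \<Longrightarrow> u * v \<in> Tdeg (r + s)"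
  using keys_mult[of u v] by (fastforce simp: Tdeg_def plus_list_def)

lemma Tdeg_prod_list: "set ws \<subseteq> Tdeg 1 \<Longrightarrow> prod_list ws \<in> Tdeg (length ws)"
proof (induction ws)
  case Nil
  then show ?case by (simp add: Tdeg_def zero_list_def)
next
  case (Cons a ws)
  then show ?case using Tdeg_mult[of a 1 "prod_list ws" "length ws"] by simp
qed

lemma pairing_prod_list:
  assumes "set ws \<subseteq> Tdeg 1" "set zs \<subseteq> Tdeg 1"
  shows "pairing (prod_list ws) (prod_list zs) =
    (if length ws = length zs then \<Prod>k<length ws. pairing (ws ! k) (zs ! k) else 0)"
proof (cases "length ws = length zs")
  case True
  then show ?thesis using assms
  proof (induction ws zs rule: list_induct2)
    case Nil
    then show ?case by (simp add: pairing_eq)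
  next
    case (Cons x xs y ys)
    then show ?case
      by (simp add: pairing_mult[of x 1 y] prod.lessThan_Suc_shift del: prod.lessThan_Suc)
  qed
next
  case False
  have "prod_list ws \<in> Tdeg (length ws)" "prod_list zs \<in> Tdeg (length zs)"
    using assms by (simp_all add: Tdeg_prod_list)
  then have "word_pairing u v = 0" if "u \<in> keys (prod_list ws)" "v \<in> keys (prod_list zs)" for u v
    using False that by (auto simp: Tdeg_def word_pairing_def)
  then show ?thesis using False by (simp add: pairing_def)
qed

end

(*
  Let Sym be the space of tensors s whose coefficients satisfy
  s(..ji..) = b_ij s(..ij..) for j < i.  The operators sigma_k fix Sym pointwise, hence so does P,
  and they change an arbitrary tensor only by an element of I_R.  On leading terms P averages over
  S_n (after rescaling words by a weight); by (EA) the weighted leading coefficients of an element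
  of I_R sum to zero, so P lowers the order on I_R and is nilpotent there in each degree.  For the
  same reason a fixed point of P lies in Sym and Sym meets I_R only in 0.  So T is the direct sum of
  Sym and I_R, and P_qsym is the projection onto Sym along I_R.  Consequently F_w = F_w' exactly
  when w - w' annihilates Sym, and the annihilator of Sym is a two-sided ideal because Sym is
  stable under contracting a tensor on the left or on the right by a word.
*)
theory Submission
  imports Defs "HOL-Library.Multiset"
begin

subsection \<open>Words and the lexicographic order\<close>

text \<open>No braid relation is assumed for \<open>S\<close>, so expressions of the same
  permutation are not known to give the same operator, and P is not known to be a projection. Only
  the top layer is insensitive to this: the corrections p_ij involve letters below i, hence lie
  strictly lower in the order, and once words are divided by their weights the operators merely
  permute places there. All arguments are therefore inductions on the order, encoded as a natural
  number. (EA) rules out hidden cancellation of high terms: an element of low order is a combination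
  of generators of low order, so functionals can be tested on those. The condition defining Sym
  contains no p_ij because the corrections coming from ..ij.. and ..ji.. cancel. Being a linear
  equation at each position, it survives contraction, which is not visible from the limit that
  defines the projection.\<close>

lemma lex_le_trans:
  fixes f g h :: "'n::linorder \<Rightarrow> nat"
  assumes "lex_le f g" "lex_le g h"
  shows "lex_le f h"
proof (cases "f = g \<or> g = h")
  case False
  then obtain i k where i: "f i < g i" "\<forall>l>i. f l = g l" and k: "g k < h k" "\<forall>l>k. g l = h l"
    using assms unfolding lex_le_def by blast
  have "f (max i k) < h (max i k)"
    using i k by (cases i k rule: linorder_cases) (auto simp: max_def)
  moreover have "\<forall>l>max i k. f l = h l" using i k by simp
  ultimately show ?thesis unfolding lex_le_def by blast
qed (use assms in auto)

lemma lex_le_antisym: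
  fixes f g :: "'n::linorder \<Rightarrow> nat"
  assumes "lex_le f g" "lex_le g f"
  shows "f = g"
proof (rule ccontr)
  assume "f \<noteq> g"
  then obtain i k where i: "f i < g i" "\<forall>l>i. f l = g l" and k: "g k < f k" "\<forall>l>k. g l = f l"
    using assms unfolding lex_le_def by auto
  then show False by (cases i k rule: linorder_cases) auto
qed

lemma lex_le_total:
  fixes f g :: "'n::{finite,linorder} \<Rightarrow> nat"
  shows "lex_le f g \<or> lex_le g f"
proof (cases "f = g")
  case False
  then have ne: "{i. f i \<noteq> g i} \<noteq> {}" by auto
  define i where "i = Max {i. f i \<noteq> g i}"
  have "f i \<noteq> g i" using Max_in[OF _ ne] by (simp add: i_def)
  moreover have "\<forall>k>i. f k = g k" unfolding i_def by (metis (mono_tags, lifting) Max_ge finite mem_Collect_eq not_le)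
  ultimately show ?thesis unfolding lex_le_def by (metis linorder_neqE_nat)
qed (simp add: lex_le_def)

lemma finite_words: "finite {w :: 'n::finite list. length w = n}"
  using finite_lists_length_eq[of "UNIV :: 'n set" n] by simp

text \<open>An order-preserving encoding by numbers of the multidegrees of words of a fixed length.\<close>

definition rank :: "'n::{finite,linorder} list \<Rightarrow> nat" where
  "rank w = card {f \<in> ell ` {v. length v = length w}. lex_le f (ell w) \<and> f \<noteq> ell w}"

lemma rank_cong: "length v = length w \<Longrightarrow> ell v = ell w \<Longrightarrow> rank v = rank w"
  by (simp add: rank_def)

text \<open>The strict predecessors of \<open>ell v\<close> form a proper subset of those of
  \<open>ell w\<close>: transitivity and antisymmetry give the inclusion, and \<open>ell v\<close>
  itself lies in the second set only.\<close>

lemma rank_less: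
  assumes "length v = length w" "lex_le (ell v) (ell w)" "ell v \<noteq> ell w"
  shows "rank v < rank w"
  unfolding rank_def
proof (rule psubset_card_mono)
  show "finite {f \<in> ell ` {v. length v = length w}. lex_le f (ell w) \<and> f \<noteq> ell w}"
    by (simp add: finite_words)
  have "ell v \<in> {f \<in> ell ` {v. length v = length w}. lex_le f (ell w) \<and> f \<noteq> ell w}"
    using assms by auto
  moreover have "ell v \<notin> {f \<in> ell ` {w. length w = length v}. lex_le f (ell v) \<and> f \<noteq> ell v}"
    by simp
  moreover have "f \<noteq> ell w" if "lex_le f (ell v)" for f
    using that assms lex_le_antisym by blast
  ultimately show "{f \<in> ell ` {w. length w = length v}. lex_le f (ell v) \<and> f \<noteq> ell v} \<subset>
      {f \<in> ell ` {v. length v = length w}. lex_le f (ell w) \<and> f \<noteq> ell w}"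
    using assms lex_le_trans by (auto simp: psubset_eq)
qed

lemma rank_le_iff:
  assumes "length v = length w"
  shows "rank v \<le> rank w \<longleftrightarrow> lex_le (ell v) (ell w)"
  by (metis assms rank_less rank_cong lex_le_total lex_le_antisym nat_less_le not_le)

lemma ell_eq_iff: "ell v = ell w \<longleftrightarrow> mset v = mset w"
  by (auto simp: ell_def fun_eq_iff multiset_eq_iff count_mset)

text \<open>Makes the words of one length and one rank exactly the rearrangements of a single word,
  so they can be compared along swaps.\<close>

lemma rank_eq_iff:
  assumes "length v = length w"
  shows "rank v = rank w \<longleftrightarrow> mset v = mset w"
  using assms rank_less[of v w] rank_less[of w v] rank_cong[of v w] lex_le_total[of "ell v" "ell w"]
  by (metis ell_eq_iff less_irrefl)

text \<open>One occurrence of \<open>i\<close> is lost and the counts of all larger letters stay the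
  same. This puts the corrections \<open>p i j\<close> strictly below the leading terms.\<close>

lemma rank_less_letters:
  assumes "j < i" "a < i" "c < i"
  shows "rank (x @ [a, c] @ y) < rank (x @ [i, j] @ y)"
proof -
  have *: "ell (x @ [a, c] @ y) i < ell (x @ [i, j] @ y) i"
    using assms by (auto simp: ell_def)
  have "lex_le (ell (x @ [a, c] @ y)) (ell (x @ [i, j] @ y))"
    unfolding lex_le_def using * assms by (intro disjI2 exI[of _ i]) (auto simp: ell_def)
  then show ?thesis using * by (intro rank_less) auto
qed

section \<open>Rearrangements of words by adjacent swaps and by permutations of places\<close>

definition adj :: "('n list \<times> 'n list) set" where
  "adj = {(x @ [i, j] @ y, x @ [j, i] @ y) | x i j y. True}"

lemma adj_Cons: "(v, w) \<in> adj\<^sup>* \<Longrightarrow> (a # v, a # w) \<in> adj\<^sup>*"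
proof (induction rule: rtrancl_induct)
  case (step y z)
  then obtain s i j t where "y = s @ [i, j] @ t" "z = s @ [j, i] @ t" by (auto simp: adj_def)
  then have "a # y = (a # s) @ [i, j] @ t" "a # z = (a # s) @ [j, i] @ t" by simp_all
  then have "(a # y, a # z) \<in> adj" unfolding adj_def by blast
  then show ?case using step by simp
qed simp

lemma adj_move: "(a # x @ y, x @ a # y) \<in> adj\<^sup>*"
proof (induction x)
  case (Cons c x)
  have "(a # c # x @ y, c # a # x @ y) \<in> adj"
    unfolding adj_def by (force intro: exI[of _ "[]"])
  then show ?case using adj_Cons[OF Cons, of c] by (auto intro: converse_rtrancl_into_rtrancl)
qed simp

text \<open>Insertion sort: the tails are matched by induction, then the first letter is carried by
  adjacent swaps to its place in \<open>w\<close>.\<close>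

lemma adj_mset: "mset v = mset w \<Longrightarrow> (v, w) \<in> adj\<^sup>*"
proof (induction v arbitrary: w)
  case (Cons a v)
  then have "a \<in> set w" by (metis list.set_intros(1) mset_eq_setD)
  then obtain x y where w: "w = x @ a # y" by (meson split_list)
  with Cons.prems have "mset v = mset (x @ y)" by simp
  then have "(a # v, a # x @ y) \<in> adj\<^sup>*" by (intro adj_Cons Cons.IH)
  then show ?case using adj_move[of a x y] w by (metis rtrancl_trans)
qed simp

lemma mset_swap_invariant:
  assumes "\<And>x i j y. H (x @ [i, j] @ y) = H (x @ [j, i] @ y)" and "mset v = mset w"
  shows "H v = H w"
  using adj_mset[OF assms(2)]
  by (induction rule: rtrancl_induct) (auto simp: adj_def assms(1)[simplified])

text \<open>Permutations act on positions counted from 1 while lists are indexed from 0, whence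
  \<open>Suc\<close> and \<open>- 1\<close>. The result reads the word through \<sigma>, so this is
  a right action.\<close>

definition permute_places :: "(nat \<Rightarrow> nat) \<Rightarrow> 'n list \<Rightarrow> 'n list" where
  "permute_places \<sigma> w = map (\<lambda>k. w ! (\<sigma> (Suc k) - 1)) [0..<length w]"

lemma length_permute_places [simp]: "length (permute_places \<sigma> w) = length w"
  by (simp add: permute_places_def)

lemma nth_permute_places: "k < length w \<Longrightarrow> permute_places \<sigma> w ! k = w ! (\<sigma> (Suc k) - 1)"
  by (simp add: permute_places_def)

lemma permute_places_id: "permute_places id w = w"
  by (simp add: permute_places_def map_nth)

lemma permute_places_comp:
  assumes "\<tau> permutes {1..length w}"
  shows "permute_places \<tau> (permute_places \<sigma> w) = permute_places (\<sigma> \<circ> \<tau>) w"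
proof (rule nth_equalityI)
  fix k assume k: "k < length (permute_places \<tau> (permute_places \<sigma> w))"
  then have "\<tau> (Suc k) \<in> {1..length w}" using permutes_in_image[OF assms, of "Suc k"] by simp
  then show "permute_places \<tau> (permute_places \<sigma> w) ! k = permute_places (\<sigma> \<circ> \<tau>) w ! k" using k by (auto simp: nth_permute_places)
qed simp

lemma permute_places_transpose:
  "permute_places (transpose (Suc (length x)) (Suc (Suc (length x)))) (x @ [i, j] @ y) = x @ [j, i] @ y"
proof (rule nth_equalityI)
  fix k assume "k < length (permute_places (transpose (Suc (length x)) (Suc (Suc (length x)))) (x @ [i, j] @ y))"
  then have k: "k < length x + 2 + length y" by simp
  consider "k < length x" | "k = length x" | "k = Suc (length x)" | "Suc (length x) < k" by linarith
  then show "permute_places (transpose (Suc (length x)) (Suc (Suc (length x)))) (x @ [i, j] @ y) ! k =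
      (x @ [j, i] @ y) ! k"
  proof cases
    case 4
    then obtain d where "k = length x + 2 + d"
      by (metis Suc_leI add.commute add_2_eq_Suc le_Suc_ex add_Suc)
    then show ?thesis using k by (simp add: nth_permute_places nth_append transpose_def)
  qed (use k in \<open>auto simp: nth_permute_places nth_append transpose_def\<close>)
qed simp

lemma transpose_permutes: "1 \<le> j \<Longrightarrow> j < n \<Longrightarrow> transpose j (Suc j) permutes {1..n}"
  by (rule permutes_swap_id) auto

lemma word_split:
  assumes "1 \<le> j" "j < length w"
  obtains x i k y where "w = x @ [i, k] @ y" "j = Suc (length x)"
proof -
  have "w = take (j - 1) w @ [w ! (j - 1), w ! j] @ drop (Suc j) w"
    using assms id_take_nth_drop[of "j - 1" w] Cons_nth_drop_Suc[of j w] by simp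
  then show ?thesis using assms that[of "take (j - 1) w"] by simp
qed

lemma mset_permute_places:
  assumes "\<sigma> permutes {1..length w}"
  shows "mset (permute_places \<sigma> w) = mset w"
proof -
  have "bij_betw (\<lambda>k. \<sigma> (Suc k) - 1) {0..<length w} {0..<length w}"
  proof -
    have "bij_betw Suc {0..<length w} {1..length w}"
      by (rule bij_betwI[of _ _ _ "\<lambda>k. k - 1"]) auto
    then have "bij_betw (\<sigma> \<circ> Suc) {0..<length w} {1..length w}"
      using permutes_imp_bij[OF assms] by (rule bij_betw_trans)
    moreover have "bij_betw (\<lambda>k. k - 1) {1..length w} {0..<length w}"
      by (rule bij_betwI[of _ _ _ Suc]) auto
    ultimately have "bij_betw ((\<lambda>k. k - 1) \<circ> (\<sigma> \<circ> Suc)) {0..<length w} {0..<length w}"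
      by (rule bij_betw_trans)
    then show ?thesis by (simp only: o_def)
  qed
  then have "image_mset (\<lambda>k. \<sigma> (Suc k) - 1) (mset_set {0..<length w}) = mset_set {0..<length w}"
    by (simp add: bij_betw_def image_mset_mset_set)
  then have "image_mset ((!) w) (image_mset (\<lambda>k. \<sigma> (Suc k) - 1) (mset_set {0..<length w})) =
      image_mset ((!) w) (mset_set {0..<length w})" by simp
  moreover have "image_mset ((!) w) (mset_set {0..<length w}) = mset w"
    by (metis map_nth mset_map mset_upt)
  ultimately show ?thesis
    by (simp add: permute_places_def image_mset.compositionality o_def)
qed

subsection \<open>Linear extensions and homogeneous parts\<close>

lemma lin_ext_superset:
  assumes "finite A" "keys u \<subseteq> A"
  shows "lin_ext f u = (\<Sum>w\<in>A. scal (lookup u w) (f w))"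
  unfolding lin_ext_def by (rule sum.mono_neutral_left) (use assms in \<open>auto simp: in_keys_iff\<close>)

lemma lin_ext_add: "lin_ext f (u + v) = lin_ext f u + lin_ext f v"
proof -
  have "lin_ext f x = (\<Sum>w\<in>keys u \<union> keys v. scal (lookup x w) (f w))"
    if "x \<in> {u, v, u + v}" for x
    using that Poly_Mapping.keys_add[of u v] by (intro lin_ext_superset) auto
  then show ?thesis by (simp add: lookup_add tens.scale_left_distrib sum.distrib)
qed

lemma lin_ext_scal: "lin_ext f (scal c u) = scal c (lin_ext f u)"
proof -
  have "lin_ext f (scal c u) = (\<Sum>w\<in>keys u. scal (lookup (scal c u) w) (f w))"
    by (rule lin_ext_superset) (auto simp: in_keys_iff lookup_scal)
  then show ?thesis by (simp add: lookup_scal tens.scale_sum_right lin_ext_def)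
qed

lemma lin_ext_mon: "lin_ext f (mon w) = f w"
  by (simp add: lin_ext_def)

lemma scal_single: "scal c (Poly_Mapping.single w d) = Poly_Mapping.single w (c * d)"
  by (rule poly_mapping_eqI) (simp add: lookup_scal lookup_single when_def)

text \<open>Scalars are the multiples of the empty word, which is central; compatibility of
  \<open>scal\<close> with products then becomes associativity.\<close>

lemma single_Nil_mult:
  "Poly_Mapping.single [] c * u = scal c u" "u * Poly_Mapping.single [] c = scal c u"
proof -
  let ?u = "\<Sum>w\<in>keys u. Poly_Mapping.single w (lookup u w)"
  have "Poly_Mapping.single [] c * ?u = scal c ?u" "?u * Poly_Mapping.single [] c = scal c ?u"
    by (simp_all add: tens.scale_sum_right scal_single sum_distrib_left sum_distrib_right
        mult_single plus_list_def mult.commute)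
  then show "Poly_Mapping.single [] c * u = scal c u" "u * Poly_Mapping.single [] c = scal c u"
    by (simp_all only: tensor_expand[of u, symmetric])
qed

lemma scal_mult_left: "scal c u * v = scal c (u * v)"
  by (simp only: single_Nil_mult(1)[symmetric] mult.assoc)

lemma scal_mult_right: "u * scal c v = scal c (u * v)"
  by (simp only: single_Nil_mult(2)[symmetric] mult.assoc)

lemma mon_mult: "mon x * mon y = mon (x @ y)"
  by (simp add: mult_single plus_list_def)

lemma mon_Nil: "mon [] = 1"
  by (metis single_one zero_list_def)

lemma tensor_expand_scal: "u = (\<Sum>w\<in>keys u. scal (lookup u w) (mon w))"
  unfolding scal_single mult_1_right by (rule tensor_expand)

lemma tensor_span: "keys u \<subseteq> A \<Longrightarrow> u \<in> tens.span (mon ` A)"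
  by (subst tensor_expand_scal[of u])
    (intro tens.span_sum tens.span_scale tens.span_base, blast)

lemma lookup_hom_part: "lookup (hom_part r u) w = (if length w = r then lookup u w else 0)"
  by (auto simp: hom_part_def mapp.rep_eq when_def in_keys_iff)

lemma subspace_Tdeg: "tens.subspace (Tdeg r)"
  using Poly_Mapping.keys_add
  by (fastforce simp: tens.subspace_def Tdeg_def in_keys_iff lookup_scal)

lemma mon_Tdeg: "mon w \<in> Tdeg n \<longleftrightarrow> length w = n"
  by (simp add: Tdeg_def)

lemma hom_part_Tdeg: "hom_part r u \<in> Tdeg r"
  by (auto simp: Tdeg_def in_keys_iff lookup_hom_part split: if_splits)

lemma hom_part_same: "u \<in> Tdeg r \<Longrightarrow> hom_part r u = u"
  by (rule poly_mapping_eqI) (auto simp: Tdeg_def in_keys_iff lookup_hom_part)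

lemma hom_part_other: "u \<in> Tdeg r \<Longrightarrow> r \<noteq> s \<Longrightarrow> hom_part s u = 0"
  by (rule poly_mapping_eqI) (auto simp: Tdeg_def in_keys_iff lookup_hom_part)

lemma sum_hom_part: "(\<Sum>n\<in>length ` keys u. hom_part n u) = u"
  by (rule poly_mapping_eqI)
    (auto simp: lookup_sum lookup_hom_part sum.delta' in_keys_iff image_iff)

lemma tens_lim_eventually_const:
  assumes "\<And>M. M \<ge> M0 \<Longrightarrow> U M = v"
  shows "tens_lim U = v"
  unfolding tens_lim_def
proof (rule the_equality)
  have lim: "(\<lambda>M. lookup (U M) w) \<longlonglongrightarrow> lookup v w" for w
    by (rule tendsto_eventually) (use assms in \<open>auto simp: eventually_sequentially intro!: exI[of _ M0]\<close>)
  then show "\<forall>w. (\<lambda>M. lookup (U M) w) \<longlonglongrightarrow> lookup v w" by blast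
  fix v' assume "\<forall>w. (\<lambda>M. lookup (U M) w) \<longlonglongrightarrow> lookup v' w"
  then show "v' = v" using lim LIMSEQ_unique by (blast intro: poly_mapping_eqI)
qed

section \<open>Ideals and linear subspaces\<close>

lemma two_sided_ideal_ideal_gen: "two_sided_ideal (ideal_gen G)"
  by (auto simp: two_sided_ideal_def ideal_gen_def)

lemma ideal_gen_superset: "G \<subseteq> ideal_gen G"
  by (auto simp: ideal_gen_def)

lemma ideal_gen_minimal: "two_sided_ideal I \<Longrightarrow> G \<subseteq> I \<Longrightarrow> ideal_gen G \<subseteq> I"
  by (auto simp: ideal_gen_def)

lemma hom_part_add: "hom_part r (u + v) = hom_part r u + hom_part r v"
  by (rule poly_mapping_eqI) (simp add: lookup_hom_part lookup_add)

lemma hom_part_scal: "hom_part r (scal c u) = scal c (hom_part r u)"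
  by (rule poly_mapping_eqI) (simp add: lookup_hom_part lookup_scal)

lemma hom_part_zero: "hom_part r 0 = 0"
  by (rule poly_mapping_eqI) (simp add: lookup_hom_part)

lemma two_sided_ideal_subspace:
  assumes "two_sided_ideal I"
  shows "tens.subspace I"
proof -
  have "scal c u \<in> I" if "u \<in> I" for c u
    using assms that unfolding single_Nil_mult(1)[symmetric] two_sided_ideal_def by blast
  then show ?thesis using assms by (auto simp: two_sided_ideal_def tens.subspace_def)
qed

lemma two_sided_idealI:
  assumes "tens.subspace I"
    and "\<And>x u. u \<in> I \<Longrightarrow> mon x * u \<in> I" "\<And>x u. u \<in> I \<Longrightarrow> u * mon x \<in> I"
  shows "two_sided_ideal I"
proof -
  have "a * u \<in> I" "u * a \<in> I" if "u \<in> I" for a u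
  proof -
    let ?a = "\<Sum>w\<in>keys a. scal (lookup a w) (mon w)"
    have "?a * u \<in> I" "u * ?a \<in> I"
      unfolding sum_distrib_left sum_distrib_right scal_mult_left scal_mult_right
      by (intro tens.subspace_sum tens.subspace_scale assms that)+
    then show "a * u \<in> I" "u * a \<in> I"
      by (simp_all only: tensor_expand_scal[of a, symmetric])
  qed
  then show ?thesis using assms(1) by (auto simp: two_sided_ideal_def tens.subspace_def)
qed

section \<open>Linearity of the operators\<close>

lemma sigma_op_add: "sigma_op b p j (u + v) = sigma_op b p j u + sigma_op b p j v"
  by (simp add: sigma_op_def lin_ext_add)

lemma sigma_op_scal: "sigma_op b p j (scal c u) = scal c (sigma_op b p j u)"
  by (simp add: sigma_op_def lin_ext_scal)

lemma sigma_op_expand: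
  assumes "finite A" "keys u \<subseteq> A"
  shows "sigma_op b p j u = (\<Sum>w\<in>A. scal (lookup u w) (sigma_op b p j (mon w)))"
  unfolding sigma_op_def lin_ext_mon by (rule lin_ext_superset[OF assms])

lemma sigma_op_mon_in:
  "sigma_op b p (Suc (length x)) (mon (x @ [i, k] @ y)) = mon x * S_op b p i k * mon y"
  by (simp add: sigma_op_def lin_ext_mon nth_append)

lemma sigma_op_mon_out: "\<not> (1 \<le> j \<and> j < length w) \<Longrightarrow> sigma_op b p j (mon w) = mon w"
  by (auto simp: sigma_op_def lin_ext_mon)

lemma sigma_hat_Nil: "sigma_hat b p [] u = u"
  by (simp add: sigma_hat_def)

lemma sigma_hat_Cons: "sigma_hat b p (j # js) u = sigma_op b p j (sigma_hat b p js u)"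
  by (simp add: sigma_hat_def)

lemma sigma_hat_add: "sigma_hat b p js (u + v) = sigma_hat b p js u + sigma_hat b p js v"
  by (induction js) (simp_all add: sigma_hat_Nil sigma_hat_Cons sigma_op_add)

lemma P_op_add: "P_op b p ex n (u + v) = P_op b p ex n u + P_op b p ex n v"
  by (simp add: P_op_def sigma_hat_add sum.distrib tens.scale_right_distrib)

lemma P_op_funpow_add:
  "(P_op b p ex n ^^ M) (u + v) = (P_op b p ex n ^^ M) u + (P_op b p ex n ^^ M) v"
  by (induction M) (simp_all add: P_op_add)

text \<open>Dividing words by their weight turns the leading part of each \<open>\<sigma>\<^sub>i\<close> into a plain swap of
  two letters.\<close>

fun weight :: "('n::linorder \<Rightarrow> 'n \<Rightarrow> complex) \<Rightarrow> 'n list \<Rightarrow> complex" where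
  "weight b [] = 1"
| "weight b (x # w) = prod_list (map (\<lambda>y. if y < x then b x y else 1) w) * weight b w"

text \<open>The weight is the product of \<open>b\<close> over all inversions of the word, and
  exchanging two adjacent letters affects only the inversion formed by these two.\<close>

lemma weight_swap:
  assumes "j < i"
  shows "weight b (x @ [i, j] @ y) = b i j * weight b (x @ [j, i] @ y)"
  using assms by (induction x) (auto simp: algebra_simps)

text \<open>The bound is strict, so \<open>Fil n 0\<close> is zero and an element of
  \<open>Fil n (Suc m)\<close> has its leading part on \<open>level n m\<close>.\<close>

definition Fil :: "nat \<Rightarrow> nat \<Rightarrow> 'n::{finite,linorder} tensor set" where
  "Fil n m = {u. \<forall>w\<in>keys u. length w = n \<and> rank w < m}"

lemma subspace_Fil: "tens.subspace (Fil n m)"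
  using Poly_Mapping.keys_add
  by (fastforce simp: tens.subspace_def Fil_def in_keys_iff lookup_scal)

lemma mon_Fil: "mon w \<in> Fil n m \<longleftrightarrow> length w = n \<and> rank w < m"
  by (simp add: Fil_def)

lemma Fil_Tdeg: "u \<in> Fil n m \<Longrightarrow> u \<in> Tdeg n"
  by (auto simp: Fil_def Tdeg_def)

lemma rank_swap: "rank (x @ [i, j] @ y) = rank (x @ [j, i] @ y)"
  by (rule rank_cong) (auto simp: ell_eq_iff)

lemma rank_permute_places: "\<sigma> permutes {1..length w} \<Longrightarrow> rank (permute_places \<sigma> w) = rank w"
  by (intro rank_cong) (simp_all add: ell_eq_iff mset_permute_places)

definition level :: "nat \<Rightarrow> nat \<Rightarrow> 'n::{finite,linorder} list set" where
  "level n m = {w. length w = n \<and> rank w = m}"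

lemma finite_level: "finite (level n m)"
  unfolding level_def by (rule finite_subset[OF _ finite_words[of n]]) auto

text \<open>Swaps connect all words of a level, so \<open>H\<close> is constant there and the sum is
  its value times the number of words, which is nonzero in characteristic 0.\<close>

lemma level_invariant_zero:
  fixes H :: "'n::{finite,linorder} list \<Rightarrow> complex"
  assumes "\<And>x i j y. H (x @ [i, j] @ y) = H (x @ [j, i] @ y)"
    and "(\<Sum>v\<in>level n m. H v) = 0" "w \<in> level n m"
  shows "H w = 0"
proof -
  have const: "H v = H w" if "v \<in> level n m" for v
  proof -
    have "mset v = mset w" using that assms(3) rank_eq_iff[of v w] by (simp add: level_def)
    then show ?thesis by (rule mset_swap_invariant[where H = H, OF assms(1)])
  qed
  have "(\<Sum>v\<in>level n m. H v) = (\<Sum>v::'n list\<in>level n m. H w)"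
    by (rule sum.cong[OF refl const])
  then have "of_nat (card (level n m :: 'n list set)) * H w = 0" using assms(2) by simp
  moreover have "card (level n m :: 'n list set) \<noteq> 0" using assms(3) finite_level[of n m] by (metis card_eq_0_iff empty_iff)
  ultimately show ?thesis by simp
qed

lemma pairing_single_left: "pairing (Poly_Mapping.single u c) s = c * lookup s u"
  by (simp add: pairing_eq)

lemma pairing_scal_left: "pairing (scal c w) s = c * pairing w s"
proof -
  have "pairing (scal c w) s = (\<Sum>u\<in>keys w. lookup (scal c w) u * lookup s u)"
    by (rule pairing_superset) (auto simp: in_keys_iff lookup_scal)
  then show ?thesis by (simp add: pairing_eq lookup_scal sum_distrib_left mult.assoc)
qed

subsection \<open>The relation ideal and the symmetric tensors\<close>

locale quadratic =
  fixes b :: "'n::{finite,linorder} \<Rightarrow> 'n \<Rightarrow> complex"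
    and p :: "'n \<Rightarrow> 'n \<Rightarrow> 'n tensor"
  assumes b_nonzero: "j < i \<Longrightarrow> b i j \<noteq> 0"
    and p_keys: "j < i \<Longrightarrow> keys (p i j) \<subseteq> {[a, c] | a c. a < i \<and> c < i}"
    and EA: "EA b p"
begin

lemma weight_nonzero: "weight b w \<noteq> 0"
  by (induction w) (auto simp: prod_list_zero_iff b_nonzero)

definition gens :: "'n tensor set" where
  "gens = {mon x * rel b p i j * mon y | x i j y. j < i}"

lemma two_sided_ideal_I_R: "two_sided_ideal (I_R b p)"
  unfolding I_R_def by (rule two_sided_ideal_ideal_gen)

lemma subspace_I_R: "tens.subspace (I_R b p)"
  by (rule two_sided_ideal_subspace[OF two_sided_ideal_I_R])

lemma gen_I_R:
  assumes "j < i"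
  shows "mon x * rel b p i j * mon y \<in> I_R b p"
proof -
  have mult: "a * u \<in> I_R b p" "u * a \<in> I_R b p" if "u \<in> I_R b p" for a u
    using two_sided_ideal_I_R that unfolding two_sided_ideal_def by simp_all
  have "rel b p i j \<in> {rel b p i j | i j. j < i}" using assms by blast
  then have "rel b p i j \<in> I_R b p"
    unfolding I_R_def by (rule subsetD[OF ideal_gen_superset])
  then show ?thesis by (intro mult)
qed

lemma span_gens_mult:
  assumes "u \<in> tens.span gens"
  shows "mon z * u \<in> tens.span gens" "u * mon z \<in> tens.span gens"
proof -
  have sub: "tens.subspace {u. mon z * u \<in> tens.span gens}"
    "tens.subspace {u. u * mon z \<in> tens.span gens}"
    by (auto simp: tens.subspace_def algebra_simps scal_mult_left scal_mult_right
        intro: tens.span_zero tens.span_add tens.span_scale)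
  have "mon z * u \<in> tens.span gens \<and> u * mon z \<in> tens.span gens" if gen: "u \<in> gens" for u
  proof -
    obtain x i j y where "j < i" "u = mon x * rel b p i j * mon y"
      using gen by (auto simp: gens_def)
    moreover have "mon z * (mon x * rel b p i j * mon y) = mon (z @ x) * rel b p i j * mon y"
      "mon x * rel b p i j * mon y * mon z = mon x * rel b p i j * mon (y @ z)"
      by (simp_all only: mon_mult[symmetric] mult.assoc)
    ultimately show ?thesis unfolding gens_def by (auto intro!: tens.span_base)
  qed
  then have "gens \<subseteq> {u. mon z * u \<in> tens.span gens}" "gens \<subseteq> {u. u * mon z \<in> tens.span gens}"
    by auto
  then show "mon z * u \<in> tens.span gens" "u * mon z \<in> tens.span gens"
    using assms tens.span_minimal sub by blast+
qed

text \<open>Linear conditions on the ideal, such as stability under homogeneous parts, can now be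
  checked on generators.\<close>

lemma I_R_eq_span: "I_R b p = tens.span gens"
proof
  have "gens \<subseteq> I_R b p"
    unfolding gens_def by (clarify, rule gen_I_R)
  then show "tens.span gens \<subseteq> I_R b p"
    by (rule tens.span_minimal[OF _ subspace_I_R])
  have ideal: "two_sided_ideal (tens.span gens)"
    by (rule two_sided_idealI[OF tens.subspace_span]) (fact span_gens_mult)+
  have "rel b p i j \<in> tens.span gens" if "j < i" for i j
  proof -
    have "mon [] * rel b p i j * mon [] \<in> gens" unfolding gens_def using that by blast
    then have "rel b p i j \<in> gens" by (simp only: mon_Nil mult_1_left mult_1_right)
    then show ?thesis by (rule tens.span_base)
  qed
  then have "{rel b p i j | i j. j < i} \<subseteq> tens.span gens" by blast
  then show "I_R b p \<subseteq> tens.span gens"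
    unfolding I_R_def by (rule ideal_gen_minimal[OF ideal])
qed

lemma gen_expand:
  "mon x * rel b p i j * mon y =
     mon (x @ [i, j] @ y) - scal (b i j) (mon (x @ [j, i] @ y)) - mon x * p i j * mon y"
  by (simp only: rel_def right_diff_distrib left_diff_distrib scal_mult_left scal_mult_right
      mon_mult append_assoc)

lemma p_term_keys:
  assumes "j < i" "w \<in> keys (mon x * p i j * mon y)"
  shows "length w = length (x @ [i, j] @ y)" "rank w < rank (x @ [i, j] @ y)"
proof -
  obtain w1 where w: "w = w1 @ y" "w1 \<in> keys (mon x * p i j)"
    using assms(2) keys_mult[of "mon x * p i j" "mon y"] by (auto simp: plus_list_def)
  then obtain w2 where "w1 = x @ w2" "w2 \<in> keys (p i j)"
    using keys_mult[of "mon x" "p i j"] by (auto simp: plus_list_def)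
  then obtain a c where "w = x @ [a, c] @ y" "a < i" "c < i"
    using p_keys[OF assms(1)] w by auto
  then show "length w = length (x @ [i, j] @ y)" "rank w < rank (x @ [i, j] @ y)"
    using rank_less_letters[OF assms(1)] by auto
qed

lemma p_term_Fil: "j < i \<Longrightarrow> mon x * p i j * mon y \<in> Fil (length (x @ [i, j] @ y)) (rank (x @ [i, j] @ y))"
  unfolding Fil_def mem_Collect_eq by (intro ballI conjI p_term_keys)

lemma gen_Tdeg: "j < i \<Longrightarrow> mon x * rel b p i j * mon y \<in> Tdeg (length (x @ [i, j] @ y))"
  unfolding gen_expand
  using Fil_Tdeg[OF p_term_Fil]
  by (intro tens.subspace_diff tens.subspace_scale subspace_Tdeg) (simp_all add: mon_Tdeg)

text \<open>The generators are homogeneous because each \<open>p i j\<close> has degree 2, so the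
  ideal is graded.\<close>

lemma hom_part_I_R: "u \<in> I_R b p \<Longrightarrow> hom_part n u \<in> I_R b p"
proof -
  have "tens.subspace {u. hom_part n u \<in> I_R b p}"
    using subspace_I_R by (auto simp: tens.subspace_def hom_part_add hom_part_scal hom_part_zero)
  moreover have "hom_part n u \<in> I_R b p" if gen: "u \<in> gens" for u
  proof -
    obtain x i j y where u: "j < i" "u = mon x * rel b p i j * mon y"
      using gen by (auto simp: gens_def)
    have "u \<in> Tdeg (length (x @ [i, j] @ y))" unfolding u(2) by (rule gen_Tdeg[OF u(1)])
    then have "hom_part n u = u \<or> hom_part n u = 0"
      by (metis hom_part_same hom_part_other)
    then show ?thesis
      using gen tens.subspace_0[OF subspace_I_R] unfolding I_R_eq_span
      by (auto intro: tens.span_base)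
  qed
  ultimately have "tens.span gens \<subseteq> {u. hom_part n u \<in> I_R b p}"
    by (intro tens.span_minimal) auto
  then show "u \<in> I_R b p \<Longrightarrow> hom_part n u \<in> I_R b p" unfolding I_R_eq_span by blast
qed

lemma EA_span:
  assumes "u \<in> I_R b p" "u \<in> Fil n m"
  shows "u \<in> tens.span {mon x * rel b p i j * mon y | x i j y.
           j < i \<and> length (x @ [i, j] @ y) = n \<and> rank (x @ [i, j] @ y) < m}"
    (is "u \<in> tens.span ?G")
proof (cases "u = 0")
  case False
  then have ne: "rank ` keys u \<noteq> {}" by simp
  have "Max (rank ` keys u) \<in> rank ` keys u" using ne by (intro Max_in) auto
  then obtain w where w: "w \<in> keys u" "rank w = Max (rank ` keys u)" by auto
  have len: "length v = n" if "v \<in> keys u" for v using that assms(2) by (auto simp: Fil_def)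
  have le: "lex_le (ell v) (ell w)" if "v \<in> keys u" for v
    using rank_le_iff[of v w] len that w by simp
  have "tord u = ell w"
    unfolding tord_def using w(1) le lex_le_antisym by (intro the_equality) blast+
  moreover have "tord (mon v) = ell v" for v :: "'n list"
    unfolding tord_def by (rule the_equality) (auto simp: lex_le_def)
  ultimately have "u \<in> tens.span {mon x * rel b p i j * mon y | x i j y.
      j < i \<and> length (x @ [i, j] @ y) = n \<and> lex_le (ell (x @ [i, j] @ y)) (ell w)}"
    using EA assms(1) Fil_Tdeg[OF assms(2)] False unfolding EA_def by fastforce
  moreover have "{mon x * rel b p i j * mon y | x i j y.
      j < i \<and> length (x @ [i, j] @ y) = n \<and> lex_le (ell (x @ [i, j] @ y)) (ell w)} \<subseteq> ?G"
  proof -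
    have "rank v < m" if "length v = n" "lex_le (ell v) (ell w)" for v
      using that rank_le_iff[of v w] len[OF w(1)] w(1) assms(2) by (auto simp: Fil_def)
    then show ?thesis by blast
  qed
  ultimately show ?thesis using tens.span_mono by blast
qed (simp add: tens.span_zero)

section \<open>Weighted leading coefficients of relations\<close>

definition level_sum :: "nat \<Rightarrow> nat \<Rightarrow> 'n tensor \<Rightarrow> complex" where
  "level_sum n m u = (\<Sum>w\<in>level n m. weight b w * lookup u w)"

lemma level_sum_mon: "level_sum n m (mon v) = (if v \<in> level n m then weight b v else 0)"
  by (simp add: level_sum_def lookup_single when_def finite_level if_distrib sum.delta cong: if_cong)

lemma level_sum_add: "level_sum n m (u + v) = level_sum n m u + level_sum n m v"
  by (simp add: level_sum_def lookup_add algebra_simps sum.distrib)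

lemma level_sum_scal: "level_sum n m (scal c u) = c * level_sum n m u"
  by (simp add: level_sum_def lookup_scal sum_distrib_left mult.left_commute)

lemma level_sum_diff: "level_sum n m (u - v) = level_sum n m u - level_sum n m v"
  by (simp only: level_sum_def lookup_minus right_diff_distrib sum_subtractf)

lemma lookup_Fil: "u \<in> Fil n m \<Longrightarrow> m \<le> rank w \<Longrightarrow> lookup u w = 0"
  by (rule ccontr) (auto simp: Fil_def in_keys_iff[symmetric])

lemma level_sum_Fil: "u \<in> Fil n m \<Longrightarrow> level_sum n m u = 0"
  unfolding level_sum_def by (rule sum.neutral) (simp add: level_def lookup_Fil)

text \<open>On its own level a generator contributes
  \<open>weight (..ij..) - b i j * weight (..ji..)\<close>, which is zero, and its \<open>p\<close>
  part lies lower. (EA) keeps generators with higher leading words out of the expression of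
  \<open>u\<close>.\<close>

lemma level_sum_I_R:
  assumes "u \<in> I_R b p" "u \<in> Fil n (Suc m)"
  shows "level_sum n m u = 0"
proof -
  have "level_sum n m (mon x * rel b p i j * mon y) = 0"
    if "j < i" "length (x @ [i, j] @ y) = n" "rank (x @ [i, j] @ y) < Suc m" for x i j y
  proof -
    have "mon x * p i j * mon y \<in> Fil n m"
      using p_term_Fil[OF that(1), of x y] that(2,3) unfolding Fil_def by fastforce
    then show ?thesis
      using that weight_swap[OF that(1), of b x y] rank_swap[of x i j y]
      by (simp add: gen_expand level_sum_diff level_sum_scal level_sum_mon level_sum_Fil level_def)
  qed
  moreover have "tens.subspace {u. level_sum n m u = 0}"
    by (auto simp: tens.subspace_def level_sum_add level_sum_scal) (simp add: level_sum_def)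
  ultimately have "tens.span {mon x * rel b p i j * mon y | x i j y.
      j < i \<and> length (x @ [i, j] @ y) = n \<and> rank (x @ [i, j] @ y) < Suc m} \<subseteq> {u. level_sum n m u = 0}"
    by (intro tens.span_minimal) blast+
  then show ?thesis using EA_span[OF assms] by blast
qed

section \<open>Symmetric tensors and their trivial intersection with the ideal\<close>

definition Sym :: "'n tensor set" where
  "Sym = {s. \<forall>x i j y. j < i \<longrightarrow> lookup s (x @ [j, i] @ y) = b i j * lookup s (x @ [i, j] @ y)}"

lemma SymD: "s \<in> Sym \<Longrightarrow> j < i \<Longrightarrow> lookup s (x @ [j, i] @ y) = b i j * lookup s (x @ [i, j] @ y)"
  by (simp only: Sym_def mem_Collect_eq)

lemma SymI:
  "(\<And>x i j y. j < i \<Longrightarrow> lookup s (x @ [j, i] @ y) = b i j * lookup s (x @ [i, j] @ y)) \<Longrightarrow> s \<in> Sym"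
  unfolding Sym_def mem_Collect_eq by iprover

lemma subspace_Sym: "tens.subspace Sym"
proof (rule tens.subspaceI)
  show "0 \<in> Sym" by (rule SymI) simp
  show "s + t \<in> Sym" if "s \<in> Sym" "t \<in> Sym" for s t
    by (rule SymI) (simp only: lookup_add SymD[OF that(1)] SymD[OF that(2)] distrib_left)
  show "scal c s \<in> Sym" if "s \<in> Sym" for c s
    by (rule SymI) (simp only: lookup_scal SymD[OF that] mult.left_commute)
qed

lemma hom_part_Sym:
  assumes "s \<in> Sym"
  shows "hom_part n s \<in> Sym"
proof (rule SymI)
  fix x i j y assume "(j :: 'n) < i"
  from SymD[OF assms this, of x y]
  show "lookup (hom_part n s) (x @ [j, i] @ y) = b i j * lookup (hom_part n s) (x @ [i, j] @ y)"
    unfolding lookup_hom_part by (cases "length (x @ [i, j] @ y) = n") simp_all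
qed

text \<open>Frees the defining condition from the order of the two letters, which gives the
  invariance under every swap that levels call for.\<close>

lemma Sym_swap:
  assumes "s \<in> Sym"
  shows "weight b (x @ [i, j] @ y) * lookup s (x @ [i, j] @ y) =
    weight b (x @ [j, i] @ y) * lookup s (x @ [j, i] @ y)"
proof -
  have *: "weight b (x @ [i, j] @ y) * lookup s (x @ [i, j] @ y) =
      weight b (x @ [j, i] @ y) * lookup s (x @ [j, i] @ y)" if "j < i" for i j
    by (simp only: SymD[OF assms that] weight_swap[OF that] mult.assoc mult.left_commute)
  show ?thesis using *[of i j] *[of j i] by (metis linorder_less_linear)
qed

text \<open>On the level of a word of maximal rank the weighted coefficients are constant by
  symmetry and sum to zero by membership in the ideal. They vanish, against the choice of the
  word.\<close>

lemma Sym_I_R_homogeneous: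
  assumes "s \<in> Sym" "s \<in> I_R b p" "s \<in> Tdeg n"
  shows "s = 0"
proof (rule ccontr)
  assume "s \<noteq> 0"
  then have "Max (rank ` keys s) \<in> rank ` keys s" by (intro Max_in) auto
  then obtain w where w: "w \<in> keys s" "rank w = Max (rank ` keys s)" by auto
  have "s \<in> Fil n (Suc (rank w))"
    using assms(3) w by (auto simp: Fil_def Tdeg_def less_Suc_eq_le)
  then have "level_sum n (rank w) s = 0" using assms(2) by (intro level_sum_I_R)
  moreover have "w \<in> level n (rank w)" using w(1) assms(3) by (auto simp: level_def Tdeg_def)
  ultimately have "weight b w * lookup s w = 0"
    unfolding level_sum_def
    by (intro level_invariant_zero[where H = "\<lambda>w. weight b w * lookup s w"] Sym_swap[OF assms(1)])
  then show False using w(1) weight_nonzero by (simp add: in_keys_iff)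
qed

lemma Sym_I_R:
  assumes "s \<in> Sym" "s \<in> I_R b p"
  shows "s = 0"
proof -
  have "hom_part n s = 0" for n
    by (rule Sym_I_R_homogeneous[OF hom_part_Sym[OF assms(1)] hom_part_I_R[OF assms(2)] hom_part_Tdeg])
  then show ?thesis using sum_hom_part[of s] by simp
qed

section \<open>Leading terms of the operators\<close>

lemma S_op_leading:
  "mon x * S_op b p i k * mon y -
     scal (weight b (x @ [i, k] @ y) / weight b (x @ [k, i] @ y)) (mon (x @ [k, i] @ y))
   \<in> Fil (length (x @ [i, k] @ y)) (rank (x @ [i, k] @ y))" (is "?lhs \<in> ?F")
proof (cases i k rule: linorder_cases)
  case less
  \<comment> \<open>The weight ratio is the coefficient that \<open>S_op\<close> gives to the
    exchanged word.\<close>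
  have "weight b (x @ [i, k] @ y) / weight b (x @ [k, i] @ y) = inverse (b k i)"
    using weight_swap[OF less, of b x y] weight_nonzero[of "x @ [i, k] @ y"] b_nonzero[OF less]
    by (simp add: field_simps)
  then have "?lhs = scal (- inverse (b k i)) (mon x * p k i * mon y)"
    using less by (simp add: less_not_sym S_op_def right_diff_distrib left_diff_distrib scal_mult_left
        scal_mult_right mon_mult tens.scale_right_diff_distrib)
  moreover have "mon x * p k i * mon y \<in> ?F"
    using p_term_Fil[OF less, of x y] rank_swap[of x i k y] by simp
  ultimately show ?thesis by (simp only: tens.subspace_scale[OF subspace_Fil])
next
  case equal
  then show ?thesis
    using tens.subspace_0[OF subspace_Fil] weight_nonzero by (simp add: S_op_def mon_mult)
next
  case greater
  have "weight b (x @ [i, k] @ y) / weight b (x @ [k, i] @ y) = b i k"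
    using weight_swap[OF greater, of b x y] weight_nonzero[of "x @ [k, i] @ y"]
    by (simp add: field_simps)
  then have "?lhs = mon x * p i k * mon y"
    using greater by (simp add: S_op_def distrib_left distrib_right scal_mult_left
        scal_mult_right mon_mult)
  then show ?thesis using p_term_Fil[OF greater, of x y] by simp
qed

text \<open>Between \<open>mon x\<close> and \<open>mon y\<close> the difference is
  \<open>- rel b p i k\<close> for \<open>k < i\<close>, and \<open>inverse (b k i)\<close> times
  \<open>rel b p k i\<close> for \<open>i < k\<close>.\<close>

lemma S_op_cong_I_R: "mon x * S_op b p i k * mon y - mon (x @ [i, k] @ y) \<in> I_R b p"
proof (cases i k rule: linorder_cases)
  case less
  then have "mon x * S_op b p i k * mon y - mon (x @ [i, k] @ y) =
      scal (inverse (b k i)) (mon x * rel b p k i * mon y)"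
    using b_nonzero[OF less] unfolding gen_expand
    by (simp add: less_not_sym S_op_def right_diff_distrib left_diff_distrib scal_mult_left
        scal_mult_right mon_mult tens.scale_right_diff_distrib)
  then show ?thesis using gen_I_R[OF less] by (simp add: tens.subspace_scale[OF subspace_I_R])
next
  case equal
  then show ?thesis
    using tens.subspace_0[OF subspace_I_R] by (simp add: S_op_def mon_mult)
next
  case greater
  then have "mon x * S_op b p i k * mon y - mon (x @ [i, k] @ y) =
      - (mon x * rel b p i k * mon y)"
    unfolding gen_expand
    by (simp add: S_op_def distrib_left distrib_right scal_mult_left
        scal_mult_right mon_mult)
  then show ?thesis using gen_I_R[OF greater] tens.subspace_neg[OF subspace_I_R] by simp
qed

lemma sigma_op_cong_I_R: "sigma_op b p j u - u \<in> I_R b p"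
proof -
  have "sigma_op b p j (mon w) - mon w \<in> I_R b p" for w
  proof (cases "1 \<le> j \<and> j < length w")
    case True
    then obtain x i k y where "w = x @ [i, k] @ y" "j = Suc (length x)"
      using word_split[of j w] by blast
    then show ?thesis using S_op_cong_I_R[of x i k y] sigma_op_mon_in[of b p x i k y] by simp
  next
    case False
    then show ?thesis using tens.subspace_0[OF subspace_I_R] by (simp add: sigma_op_mon_out)
  qed
  moreover have "sigma_op b p j u - u =
      (\<Sum>w\<in>keys u. scal (lookup u w) (sigma_op b p j (mon w) - mon w))"
    by (simp add: tens.scale_right_diff_distrib sum_subtractf
        sigma_op_expand[of "keys u" u, symmetric] tensor_expand_scal[of u, symmetric])
  ultimately show ?thesis
    by (simp add: tens.subspace_sum tens.subspace_scale subspace_I_R)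
qed

lemma sigma_hat_cong_I_R: "sigma_hat b p js u - u \<in> I_R b p"
proof (induction js)
  case (Cons j js)
  have "sigma_hat b p (j # js) u - u =
      (sigma_op b p j (sigma_hat b p js u) - sigma_hat b p js u) + (sigma_hat b p js u - u)"
    by (simp add: sigma_hat_Cons)
  then show ?case using Cons tens.subspace_add[OF subspace_I_R] sigma_op_cong_I_R by metis
qed (simp add: sigma_hat_Nil tens.subspace_0[OF subspace_I_R])

text \<open>Both claims are linear in \<open>u\<close>, so they are checked on words, whose image is
  the exchanged word times a weight ratio plus an error of lower rank.\<close>

lemma sigma_op_leading:
  assumes "1 \<le> j" "j < n" "u \<in> Fil n (Suc m)"
  shows "sigma_op b p j u \<in> Fil n (Suc m)"
    and "v \<in> level n m \<Longrightarrow> weight b v * lookup (sigma_op b p j u) v =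
      weight b (permute_places (transpose j (Suc j)) v) * lookup u (permute_places (transpose j (Suc j)) v)"
proof -
  let ?t = "transpose j (Suc j)"
  let ?L = "{u. sigma_op b p j u \<in> Fil n (Suc m) \<and> (\<forall>v\<in>level n m.
      weight b v * lookup (sigma_op b p j u) v = weight b (permute_places ?t v) * lookup u (permute_places ?t v))}"
  have "tens.subspace ?L"
    using subspace_Fil[of n "Suc m"] sigma_op_scal[of b p j 0 0]
    by (auto simp: tens.subspace_def sigma_op_add sigma_op_scal lookup_add lookup_scal algebra_simps)
  moreover have "mon w \<in> ?L" if w: "length w = n" "rank w < Suc m" for w
  proof -
    obtain x i k y where w': "w = x @ [i, k] @ y" "j = Suc (length x)"
      using word_split[of j w] assms w by blast
    let ?w = "x @ [k, i] @ y"
    let ?c = "weight b w / weight b ?w"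
    define e where "e = sigma_op b p j (mon w) - scal ?c (mon ?w)"
    have e: "e \<in> Fil n (rank w)"
      using S_op_leading[of x i k y] sigma_op_mon_in[of b p x i k y] w w' by (simp add: e_def)
    have sig: "sigma_op b p j (mon w) = scal ?c (mon ?w) + e" by (simp add: e_def)
    have pw: "permute_places ?t w = ?w" using permute_places_transpose[of x i k y] w' by simp
    have perm: "?t permutes {1..n}" using assms by (intro transpose_permutes)
    have "mon ?w \<in> Fil n (Suc m)" "e \<in> Fil n (Suc m)"
      using w w' e rank_swap[of x i k y] by (auto simp: mon_Fil Fil_def)
    then have "sigma_op b p j (mon w) \<in> Fil n (Suc m)"
      unfolding sig by (intro tens.subspace_add tens.subspace_scale subspace_Fil)
    moreover have "weight b v * lookup (sigma_op b p j (mon w)) v =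
        weight b (permute_places ?t v) * lookup (mon w) (permute_places ?t v)" if v: "v \<in> level n m" for v
    proof -
      have "lookup e v = 0" using lookup_Fil[OF e] v w(2) by (simp add: level_def)
      \<comment> \<open>Exchanging places is an involution, so the exchanged word is
        \<open>v\<close> exactly when the word itself is the exchanged \<open>v\<close>.\<close>
      moreover have "permute_places ?t (permute_places ?t z) = z" if "length z = n" for z :: "'n list"
        using permute_places_comp[of ?t z ?t] perm that by (simp add: transpose_comp_involutory permute_places_id)
      then have "?w = v \<longleftrightarrow> w = permute_places ?t v"
        using pw v w by (metis (mono_tags, lifting) level_def mem_Collect_eq)
      ultimately show ?thesis
        unfolding sig using weight_nonzero[of ?w]
        by (cases "?w = v") (auto simp: lookup_add lookup_scal lookup_single when_def)
    qed
    ultimately show ?thesis by blast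
  qed
  ultimately have "tens.span (mon ` {w. length w = n \<and> rank w < Suc m}) \<subseteq> ?L"
    by (intro tens.span_minimal) auto
  moreover have "u \<in> tens.span (mon ` {w. length w = n \<and> rank w < Suc m})"
    using assms(3) by (intro tensor_span) (auto simp: Fil_def)
  ultimately have "u \<in> ?L" by blast
  then show "sigma_op b p j u \<in> Fil n (Suc m)"
    "v \<in> level n m \<Longrightarrow> weight b v * lookup (sigma_op b p j u) v =
      weight b (permute_places (transpose j (Suc j)) v) * lookup u (permute_places (transpose j (Suc j)) v)"
    by blast+
qed

lemma permute_places_level: "\<sigma> permutes {1..n} \<Longrightarrow> v \<in> level n m \<Longrightarrow> permute_places \<sigma> v \<in> level n m"
  by (auto simp: level_def rank_permute_places)

lemma is_expression_permutes: "is_expression n \<sigma> js \<Longrightarrow> \<sigma> permutes {1..n}"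
proof (induction js arbitrary: \<sigma>)
  case (Cons j js)
  let ?\<pi> = "foldr (\<lambda>j \<pi>. transpose j (Suc j) \<circ> \<pi>) js id"
  have "is_expression n ?\<pi> js" using Cons.prems by (simp add: is_expression_def)
  moreover have "\<sigma> = transpose j (Suc j) \<circ> ?\<pi>" "1 \<le> j" "j < n"
    using Cons.prems by (auto simp: is_expression_def)
  ultimately show ?case using Cons.IH transpose_permutes permutes_compose by metis
qed (auto simp: is_expression_def)

text \<open>On the top level the chosen expression is invisible, since the factors act there through
  \<open>permute_places\<close>. As this is a right action, the outermost factor acts on
  \<open>v\<close> first.\<close>

lemma sigma_hat_leading:
  assumes "is_expression n \<sigma> js" "u \<in> Fil n (Suc m)"
  shows "sigma_hat b p js u \<in> Fil n (Suc m)"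
    and "v \<in> level n m \<Longrightarrow>
      weight b v * lookup (sigma_hat b p js u) v = weight b (permute_places \<sigma> v) * lookup u (permute_places \<sigma> v)"
proof -
  have "sigma_hat b p js u \<in> Fil n (Suc m) \<and> (\<forall>v\<in>level n m.
      weight b v * lookup (sigma_hat b p js u) v = weight b (permute_places \<sigma> v) * lookup u (permute_places \<sigma> v))"
    using assms(1)
  proof (induction js arbitrary: \<sigma>)
    case Nil
    then show ?case
      using assms(2) by (auto simp: sigma_hat_Nil is_expression_def permute_places_id[unfolded id_def] id_def)
  next
    case (Cons j js)
    define \<pi> where "\<pi> = foldr (\<lambda>j \<pi>. transpose j (Suc j) \<circ> \<pi>) js id"
    have \<pi>: "is_expression n \<pi> js" and \<sigma>: "\<sigma> = transpose j (Suc j) \<circ> \<pi>" and j: "1 \<le> j" "j < n"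
      using Cons.prems by (auto simp: is_expression_def \<pi>_def)
    note IH = Cons.IH[OF \<pi>]
    have "weight b v * lookup (sigma_hat b p (j # js) u) v = weight b (permute_places \<sigma> v) * lookup u (permute_places \<sigma> v)"
      if v: "v \<in> level n m" for v
    proof -
      have "permute_places (transpose j (Suc j)) v \<in> level n m"
        using permute_places_level[OF transpose_permutes[OF j] v] .
      moreover have "permute_places \<pi> (permute_places (transpose j (Suc j)) v) = permute_places \<sigma> v"
        using permute_places_comp[of \<pi> v] is_expression_permutes[OF \<pi>] v by (simp add: \<sigma> level_def)
      ultimately show ?thesis
        using IH sigma_op_leading(2)[OF j _ v] by (simp add: sigma_hat_Cons)
    qed
    then show ?case using IH sigma_op_leading(1)[OF j] by (simp add: sigma_hat_Cons)
  qed
  then show "sigma_hat b p js u \<in> Fil n (Suc m)"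
    "v \<in> level n m \<Longrightarrow>
      weight b v * lookup (sigma_hat b p js u) v = weight b (permute_places \<sigma> v) * lookup u (permute_places \<sigma> v)"
    by blast+
qed

end

subsection \<open>The symmetrizer\<close>

locale quadratic_expressions = quadratic b p
  for b :: "'n::{finite,linorder} \<Rightarrow> 'n \<Rightarrow> complex" and p :: "'n \<Rightarrow> 'n \<Rightarrow> 'n tensor" +
  fixes ex :: expr_choice
  assumes expression: "\<sigma> permutes {1..n} \<Longrightarrow> is_expression n \<sigma> (ex n \<sigma>)"
begin

lemma sum_const_permutations: "scal (1 / fact n) (\<Sum>\<sigma> | \<sigma> permutes {1..n}. u) = u"
proof -
  have "(\<Sum>\<sigma>\<in>A. u) = scal (of_nat (card A)) u" for A :: "(nat \<Rightarrow> nat) set"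
    by (induction A rule: infinite_finite_induct) (simp_all add: tens.scale_left_distrib del: sum_constant)
  moreover have "card {\<sigma>. \<sigma> permutes {1..n}} = fact n"
    by (rule card_permutations) simp_all
  ultimately show ?thesis by (simp del: sum_constant)
qed

lemma P_op_cong_I_R: "P_op b p ex n u - u \<in> I_R b p"
proof -
  have "P_op b p ex n u - u = P_op b p ex n u - scal (1 / fact n) (\<Sum>\<sigma> | \<sigma> permutes {1..n}. u)"
    by (simp only: sum_const_permutations)
  also have "\<dots> = scal (1 / fact n) (\<Sum>\<sigma> | \<sigma> permutes {1..n}. sigma_hat b p (ex n \<sigma>) u - u)"
    by (simp only: P_op_def tens.scale_right_diff_distrib[symmetric] sum_subtractf)
  finally show ?thesis
    by (simp add: tens.subspace_scale tens.subspace_sum subspace_I_R sigma_hat_cong_I_R)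
qed

lemma P_op_funpow_cong_I_R: "(P_op b p ex n ^^ M) u - u \<in> I_R b p"
proof (induction M)
  case (Suc M)
  have "(P_op b p ex n ^^ Suc M) u - u =
      (P_op b p ex n ((P_op b p ex n ^^ M) u) - (P_op b p ex n ^^ M) u) + ((P_op b p ex n ^^ M) u - u)"
    by simp
  then show ?case using Suc P_op_cong_I_R tens.subspace_add[OF subspace_I_R] by metis
qed (simp add: tens.subspace_0[OF subspace_I_R])

lemma P_op_I_R: "u \<in> I_R b p \<Longrightarrow> P_op b p ex n u \<in> I_R b p"
  using tens.subspace_add[OF subspace_I_R P_op_cong_I_R[of n u]] by fastforce

lemma P_op_Fil: "u \<in> Fil n m \<Longrightarrow> P_op b p ex n u \<in> Fil n m"
proof (cases m)
  case 0
  then show "u \<in> Fil n m \<Longrightarrow> P_op b p ex n u \<in> Fil n m"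
    using P_op_add[of b p ex n 0 0] by (simp add: Fil_def)
next
  case (Suc m')
  then show "u \<in> Fil n m \<Longrightarrow> P_op b p ex n u \<in> Fil n m"
    unfolding P_op_def
    by (auto intro!: tens.subspace_scale tens.subspace_sum subspace_Fil
        intro: sigma_hat_leading(1)[OF expression])
qed

text \<open>The leading coefficients of the image are averages over the whole group, and a swap of
  letters only reindexes the sum by left multiplication with a transposition.\<close>

lemma P_op_leading_swap:
  assumes "u \<in> Fil n (Suc m)" "x @ [i, j] @ y \<in> level n m"
  shows "weight b (x @ [i, j] @ y) * lookup (P_op b p ex n u) (x @ [i, j] @ y) =
    weight b (x @ [j, i] @ y) * lookup (P_op b p ex n u) (x @ [j, i] @ y)"
proof -
  define G where "G w = weight b w * lookup u w" for w
  let ?v = "x @ [i, j] @ y"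
  let ?t = "transpose (Suc (length x)) (Suc (Suc (length x)))"
  have lead: "weight b v * lookup (P_op b p ex n u) v =
      1 / fact n * (\<Sum>\<sigma> | \<sigma> permutes {1..n}. G (permute_places \<sigma> v))" if "v \<in> level n m" for v
  proof -
    have "weight b v * lookup (P_op b p ex n u) v =
        1 / fact n * (\<Sum>\<sigma> | \<sigma> permutes {1..n}. weight b v * lookup (sigma_hat b p (ex n \<sigma>) u) v)"
      by (simp add: P_op_def lookup_scal lookup_sum sum_distrib_left mult.left_commute)
    also have "(\<Sum>\<sigma> | \<sigma> permutes {1..n}. weight b v * lookup (sigma_hat b p (ex n \<sigma>) u) v) =
        (\<Sum>\<sigma> | \<sigma> permutes {1..n}. G (permute_places \<sigma> v))"
      unfolding G_def
      by (intro sum.cong refl sigma_hat_leading(2)[OF expression assms(1) that]) simp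
    finally show ?thesis .
  qed
  have t: "?t permutes {1..n}"
    using assms(2) by (intro transpose_permutes) (auto simp: level_def)
  have "permute_places ?t ?v \<in> level n m" by (rule permute_places_level[OF t assms(2)])
  then have "weight b (permute_places ?t ?v) * lookup (P_op b p ex n u) (permute_places ?t ?v) =
      1 / fact n * (\<Sum>\<sigma> | \<sigma> permutes {1..n}. G (permute_places \<sigma> (permute_places ?t ?v)))"
    by (rule lead)
  also have "(\<Sum>\<sigma> | \<sigma> permutes {1..n}. G (permute_places \<sigma> (permute_places ?t ?v))) =
      (\<Sum>\<sigma> | \<sigma> permutes {1..n}. G (permute_places (?t \<circ> \<sigma>) ?v))"
    using assms(2) by (intro sum.cong refl arg_cong[of _ _ G] permute_places_comp) (simp add: level_def)
  also have "\<dots> = (\<Sum>\<sigma> | \<sigma> permutes {1..n}. G (permute_places \<sigma> ?v))"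
    by (rule setum_permutations_compose_left[OF t, symmetric])
  also have "1 / fact n * \<dots> = weight b ?v * lookup (P_op b p ex n u) ?v"
    by (rule lead[OF assms(2), symmetric])
  finally show ?thesis by (simp only: permute_places_transpose)
qed

text \<open>The weighted leading coefficients of the image are constant on the level by averaging,
  and sum to zero because the image stays in the ideal.\<close>

lemma P_op_I_R_lower:
  assumes "u \<in> I_R b p" "u \<in> Fil n (Suc m)"
  shows "P_op b p ex n u \<in> Fil n m"
proof -
  \<comment> \<open>Extension by zero makes \<open>?H\<close> invariant under swaps on all words,
    not only on the level.\<close>
  let ?H = "\<lambda>w. if w \<in> level n m then weight b w * lookup (P_op b p ex n u) w else 0"
  have Fil: "P_op b p ex n u \<in> Fil n (Suc m)" by (rule P_op_Fil[OF assms(2)])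
  have swap: "?H (x @ [i, j] @ y) = ?H (x @ [j, i] @ y)" for x i j y
  proof (cases "x @ [i, j] @ y \<in> level n m")
    case True
    then have "x @ [j, i] @ y \<in> level n m" using rank_swap[of x i j y] by (simp add: level_def)
    then show ?thesis using True P_op_leading_swap[OF assms(2) True] by (simp only: if_True)
  next
    case False
    then have "x @ [j, i] @ y \<notin> level n m" using rank_swap[of x i j y] by (simp add: level_def)
    then show ?thesis using False by (simp only: if_False)
  qed
  have "(\<Sum>w\<in>level n m. ?H w) = level_sum n m (P_op b p ex n u)"
    unfolding level_sum_def by (rule sum.cong) simp_all
  then have "(\<Sum>w\<in>level n m. ?H w) = 0" using level_sum_I_R[OF P_op_I_R[OF assms(1)] Fil] by simp
  then have H0: "?H w = 0" if "w \<in> level n m" for w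
    using level_invariant_zero[where H = ?H, OF swap _ that] by blast
  have "rank w \<noteq> m" if "w \<in> keys (P_op b p ex n u)" for w
  proof
    assume "rank w = m"
    then have "w \<in> level n m" using that Fil by (simp add: Fil_def level_def)
    then show False using H0[of w] that weight_nonzero by (simp add: in_keys_iff)
  qed
  then show ?thesis using Fil unfolding Fil_def by (auto simp: less_Suc_eq)
qed

lemma P_op_nilpotent_I_R: "u \<in> I_R b p \<Longrightarrow> u \<in> Fil n m \<Longrightarrow> (P_op b p ex n ^^ m) u = 0"
proof (induction m arbitrary: u)
  case 0
  then show ?case by (simp add: Fil_def)
next
  case (Suc m)
  have "(P_op b p ex n ^^ m) (P_op b p ex n u) = 0"
    using Suc.prems by (intro Suc.IH P_op_I_R P_op_I_R_lower)
  then show ?case by (simp only: funpow_Suc_right o_apply)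
qed

text \<open>Words are paired by exchanging places \<open>j\<close> and \<open>j + 1\<close>.
  Weighted with the coefficients of \<open>s\<close>, the changes of the two partners are opposite
  multiples of one relation, so the \<open>p\<close> terms cancel as well.\<close>

lemma sigma_op_Sym:
  assumes "1 \<le> j" "j < n" "s \<in> Sym" "s \<in> Tdeg n"
  shows "sigma_op b p j s = s"
proof -
  let ?A = "{w :: 'n list. length w = n}"
  let ?t = "permute_places (transpose j (Suc j)) :: 'n list \<Rightarrow> 'n list"
  let ?f = "\<lambda>w. scal (lookup s w) (sigma_op b p j (mon w) - mon w)"
  have keys: "keys s \<subseteq> ?A" using assms(4) by (auto simp: Tdeg_def)
  have swap: "?f (x @ [i, k] @ y) + ?f (x @ [k, i] @ y) = 0"
    if "j = Suc (length x)" "k < i" for x i k y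
  proof -
    have "sigma_op b p j (mon (x @ [i, k] @ y)) - mon (x @ [i, k] @ y) = - (mon x * rel b p i k * mon y)"
      unfolding that(1) sigma_op_mon_in gen_expand using that(2)
      by (simp add: S_op_def distrib_left distrib_right scal_mult_left scal_mult_right mon_mult)
    moreover have "scal (b i k) (sigma_op b p j (mon (x @ [k, i] @ y)) - mon (x @ [k, i] @ y)) =
        mon x * rel b p i k * mon y"
      unfolding that(1) sigma_op_mon_in gen_expand using that(2) b_nonzero[OF that(2)]
      by (simp add: less_not_sym S_op_def right_diff_distrib left_diff_distrib scal_mult_left
          scal_mult_right mon_mult tens.scale_right_diff_distrib)
    moreover have "?f (x @ [k, i] @ y) = scal (lookup s (x @ [i, k] @ y))
        (scal (b i k) (sigma_op b p j (mon (x @ [k, i] @ y)) - mon (x @ [k, i] @ y)))"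
      by (simp only: SymD[OF assms(3) that(2)] tens.scale_scale mult.commute)
    ultimately show ?thesis by simp
  qed
  have pair: "?f w + ?f (?t w) = 0" if "w \<in> ?A" for w
  proof -
    from that have "j < length w" using assms(2) by simp
    then obtain x i k y where w: "w = x @ [i, k] @ y" "j = Suc (length x)"
      using word_split[OF assms(1)] by blast
    have t: "?t w = x @ [k, i] @ y" unfolding w by (rule permute_places_transpose)
    show ?thesis
    proof (cases i k rule: linorder_cases)
      case less
      then show ?thesis
        unfolding t unfolding w(1) by (subst add.commute) (rule swap[OF w(2)])
    next
      case equal
      then show ?thesis
        unfolding t unfolding w sigma_op_mon_in by (simp add: S_op_def mon_mult)
    next
      case greater
      then show ?thesis unfolding t unfolding w(1) by (rule swap[OF w(2)])
    qed
  qed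
  have invol: "?t (?t w) = w" if "w \<in> ?A" for w
    using permute_places_comp[of "transpose j (Suc j)" w "transpose j (Suc j)"] transpose_permutes[OF assms(1,2)] that
    by (simp add: transpose_comp_involutory permute_places_id)
  have "(\<Sum>w\<in>?A. ?f w) = (\<Sum>w\<in>?A. ?f (?t w))"
    by (rule sum.reindex_bij_witness[of _ ?t ?t]) (simp_all add: invol)
  \<comment> \<open>A word with equal letters at the two places is its own partner; summing over all
    words and their partners treats both kinds alike and gives twice the total change.\<close>
  then have "(\<Sum>w\<in>?A. ?f w) + (\<Sum>w\<in>?A. ?f w) = (\<Sum>w\<in>?A. ?f w + ?f (?t w))"
    by (simp only: sum.distrib)
  also have "\<dots> = 0" using pair by (intro sum.neutral) blast
  finally have "(\<Sum>w\<in>?A. ?f w) + (\<Sum>w\<in>?A. ?f w) = 0" .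
  moreover have "z = 0" if "z + z = 0" for z :: "'n tensor"
  proof -
    have "scal 2 z = 0" using tens.scale_left_distrib[of 1 1 z] that by simp
    then show ?thesis by simp
  qed
  ultimately have "(\<Sum>w\<in>?A. ?f w) = 0" by blast
  moreover have "(\<Sum>w\<in>?A. scal (lookup s w) (mon w)) = s"
    by (subst (2) tensor_expand_scal[of s])
      (rule sum.mono_neutral_right[OF finite_words keys], simp add: in_keys_iff)
  ultimately show ?thesis
    using sigma_op_expand[OF finite_words keys, of b p j]
    by (simp add: tens.scale_right_diff_distrib sum_subtractf)
qed

lemma P_op_Sym:
  assumes "s \<in> Sym" "s \<in> Tdeg n"
  shows "P_op b p ex n s = s"
proof -
  have "sigma_hat b p js s = s" if "set js \<subseteq> {1..<n}" for js
    using that by (induction js) (simp_all add: sigma_hat_Nil sigma_hat_Cons sigma_op_Sym[OF _ _ assms])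
  then have "sigma_hat b p (ex n \<sigma>) s = s" if "\<sigma> permutes {1..n}" for \<sigma>
    using expression[OF that] by (simp add: is_expression_def)
  then have "P_op b p ex n s = scal (1 / fact n) (\<Sum>\<sigma> | \<sigma> permutes {1..n}. s)"
    by (simp add: P_op_def)
  then show ?thesis by (simp only: sum_const_permutations)
qed

lemma P_op_fixed_imp_Sym:
  "u \<in> Fil n m \<Longrightarrow> P_op b p ex n u = u \<Longrightarrow> u \<in> Sym"
proof (induction m arbitrary: u)
  case 0
  then have "u = 0" by (simp add: Fil_def)
  then show ?case by (simp only: tens.subspace_0[OF subspace_Sym])
next
  case (Suc m)
  \<comment> \<open>The leading part \<open>t\<close> of \<open>u\<close> lies in \<open>Sym\<close>, so \<open>u - t\<close> is a fixed point of lower order.\<close>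
  define t where "t = Poly_Mapping.mapp (\<lambda>w c. if w \<in> level n m then c else 0) u"
  have lookup_t: "lookup t w = (if w \<in> level n m then lookup u w else 0)" for w
    by (auto simp: t_def mapp.rep_eq when_def in_keys_iff)
  have "t \<in> Sym"
  proof (rule SymI)
    fix x i j y assume ji: "(j :: 'n) < i"
    have level: "x @ [i, j] @ y \<in> level n m \<longleftrightarrow> x @ [j, i] @ y \<in> level n m"
      using rank_swap[of x i j y] by (simp add: level_def)
    show "lookup t (x @ [j, i] @ y) = b i j * lookup t (x @ [i, j] @ y)"
    proof (cases "x @ [i, j] @ y \<in> level n m")
      case True
      \<comment> \<open>For a fixed point the averaged leading coefficients are those of
        \<open>u\<close> itself; cancelling the nonzero weight leaves the \<open>Sym\<close>
        relation.\<close>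
      then have "lookup u (x @ [j, i] @ y) = b i j * lookup u (x @ [i, j] @ y)"
        using P_op_leading_swap[OF Suc.prems(1) True] weight_nonzero[of "x @ [j, i] @ y"]
        unfolding Suc.prems(2) weight_swap[OF ji] by simp
      then show ?thesis using True level by (simp only: lookup_t if_True)
    qed (use level in \<open>simp only: lookup_t if_False mult_zero_right\<close>)
  qed
  moreover have t: "t \<in> Fil n (Suc m)"
    using Suc.prems(1) by (auto simp: Fil_def in_keys_iff lookup_t level_def split: if_splits)
  ultimately have "P_op b p ex n t = t" using P_op_Sym Fil_Tdeg by blast
  then have "P_op b p ex n (u - t) = u - t"
    using P_op_add[of b p ex n "u - t" t] Suc.prems(2) by (simp add: eq_diff_eq)
  moreover have "u - t \<in> Fil n m"
  proof -
    have "u - t \<in> Fil n (Suc m)"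
      using Suc.prems(1) t by (rule tens.subspace_diff[OF subspace_Fil])
    moreover have "w \<notin> keys (u - t)" if "w \<in> level n m" for w
      using that by (simp add: in_keys_iff lookup_minus lookup_t)
    ultimately show ?thesis by (auto simp: Fil_def level_def less_Suc_eq)
  qed
  ultimately have "u - t \<in> Sym" by (intro Suc.IH)
  then show ?case using tens.subspace_add[OF subspace_Sym _ \<open>t \<in> Sym\<close>] by fastforce
qed

text \<open>The difference of \<open>u\<close> and its image lies in the ideal, so some power of the
  operator kills it. From that power on the iterates of \<open>u\<close> are constant, and their
  value is a fixed point.\<close>

lemma tens_lim_P_op:
  assumes "u \<in> Tdeg n"
  defines "v \<equiv> tens_lim (\<lambda>M. (P_op b p ex n ^^ M) u)"
  shows "v \<in> Sym" "u - v \<in> I_R b p"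
proof -
  \<comment> \<open>\<open>Suc\<close> accounts for the strict bound in \<open>Fil\<close>; for
    \<open>z = 0\<close> the value of \<open>Max\<close> is immaterial, as there are no words to
    bound.\<close>
  have Fil: "z \<in> Fil n (Suc (Max (rank ` keys z)))" if "z \<in> Tdeg n" for z :: "'n tensor"
    using that by (auto simp: Fil_def Tdeg_def less_Suc_eq_le)
  define m where "m = Suc (Max (rank ` keys (P_op b p ex n u - u)))"
  let ?v = "(P_op b p ex n ^^ m) u"
  have "P_op b p ex n u \<in> Tdeg n" by (rule Fil_Tdeg[OF P_op_Fil[OF Fil[OF assms(1)]]])
  then have "P_op b p ex n u - u \<in> Fil n m"
    unfolding m_def using assms(1) by (intro Fil tens.subspace_diff[OF subspace_Tdeg])
  then have "(P_op b p ex n ^^ m) (P_op b p ex n u - u) = 0"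
    by (rule P_op_nilpotent_I_R[OF P_op_cong_I_R])
  then have "(P_op b p ex n ^^ m) (P_op b p ex n u) = ?v"
    using P_op_funpow_add[where u = "P_op b p ex n u - u" and v = u and M = m and n = n] by simp
  then have fixed: "P_op b p ex n ?v = ?v" by (simp add: funpow_swap1)
  have "(P_op b p ex n ^^ M) u = ?v" if "M \<ge> m" for M
    using that by (induction M rule: dec_induct) (simp_all add: fixed)
  then have v: "v = ?v" unfolding v_def by (rule tens_lim_eventually_const)
  have "?v \<in> Fil n (Suc (Max (rank ` keys u)))"
  proof (induction m)
    case 0
    then show ?case using Fil[OF assms(1)] by simp
  qed (simp add: P_op_Fil)
  then show "v \<in> Sym" unfolding v by (rule P_op_fixed_imp_Sym[OF _ fixed])
  show "u - v \<in> I_R b p"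
    unfolding v using tens.subspace_neg[OF subspace_I_R P_op_funpow_cong_I_R[where u = u]] by simp
qed

lemma P_qsym_Sym: "P_qsym b p ex u \<in> Sym"
  unfolding P_qsym_def by (intro tens.subspace_sum subspace_Sym tens_lim_P_op hom_part_Tdeg)

lemma P_qsym_cong: "u - P_qsym b p ex u \<in> I_R b p"
proof -
  have "u - P_qsym b p ex u = (\<Sum>n\<in>length ` keys u. hom_part n u) - P_qsym b p ex u"
    by (simp only: sum_hom_part)
  also have "\<dots> \<in> I_R b p"
    unfolding P_qsym_def sum_subtractf[symmetric]
    by (intro tens.subspace_sum subspace_I_R tens_lim_P_op hom_part_Tdeg)
  finally show ?thesis .
qed

text \<open>Two symmetric representatives of one class differ by an element of both
  \<open>Sym\<close> and the ideal. This characterizes \<open>P_qsym\<close> without limits or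
  expressions.\<close>

lemma P_qsym_eqI:
  assumes "s \<in> Sym" "u - s \<in> I_R b p"
  shows "P_qsym b p ex u = s"
proof -
  have "(u - s) - (u - P_qsym b p ex u) \<in> I_R b p"
    by (rule tens.subspace_diff[OF subspace_I_R assms(2) P_qsym_cong])
  moreover have "P_qsym b p ex u - s \<in> Sym"
    by (rule tens.subspace_diff[OF subspace_Sym P_qsym_Sym assms(1)])
  ultimately have "P_qsym b p ex u - s = 0" by (intro Sym_I_R) simp_all
  then show ?thesis by simp
qed

lemma P_qsym_of_Sym: "s \<in> Sym \<Longrightarrow> P_qsym b p ex s = s"
  using tens.subspace_0[OF subspace_I_R] by (intro P_qsym_eqI) simp_all

lemma P_qsym_class:
  assumes "u - v \<in> I_R b p"
  shows "P_qsym b p ex u = P_qsym b p ex v"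
proof (rule P_qsym_eqI[OF P_qsym_Sym])
  have "(u - v) + (v - P_qsym b p ex v) \<in> I_R b p"
    by (rule tens.subspace_add[OF subspace_I_R assms P_qsym_cong])
  then show "u - P_qsym b p ex v \<in> I_R b p" by simp
qed

subsection \<open>The annihilator of the symmetric tensors\<close>

text \<open>The witness is the slice of the coefficients of \<open>s\<close> at words beginning with
  \<open>a\<close>. The \<open>Sym\<close> condition holds in every context, so the prefix is
  absorbed into \<open>x\<close>.\<close>

lemma Sym_contract_left:
  assumes "s \<in> Sym"
  obtains t where "t \<in> Sym" "\<And>w. pairing (mon a * w) s = pairing w t"
proof -
  \<comment> \<open>Prefixing by \<open>a\<close> is injective, so the slice has finite support and
    is a tensor.\<close>
  have "finite {v. lookup s (a @ v) \<noteq> 0}"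
    using finite_vimageI[of "keys s" "(@) a"]
    by (simp add: inj_on_def vimage_def in_keys_iff)
  then obtain t where t: "lookup t = (\<lambda>v. lookup s (a @ v))"
    using Abs_poly_mapping_inverse by fastforce
  show ?thesis
  proof
    show "t \<in> Sym"
    proof (rule SymI)
      fix x i j y assume "(j :: 'n) < i"
      from SymD[OF assms this, of "a @ x" y]
      show "lookup t (x @ [j, i] @ y) = b i j * lookup t (x @ [i, j] @ y)"
        by (simp only: t append_assoc)
    qed
    show "pairing (mon a * w) s = pairing w t" for w
    proof -
      have "pairing (mon a * w) s = pairing (\<Sum>u\<in>keys w. Poly_Mapping.single (a @ u) (lookup w u)) s"
        by (subst tensor_expand[of w]) (simp add: sum_distrib_left mult_single plus_list_def)
      then show ?thesis by (simp add: pairing_sum_left pairing_single_left pairing_eq[of w] t)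
    qed
  qed
qed

lemma Sym_contract_right:
  assumes "s \<in> Sym"
  obtains t where "t \<in> Sym" "\<And>w. pairing (w * mon a) s = pairing w t"
proof -
  have "finite {v. lookup s (v @ a) \<noteq> 0}"
    using finite_vimageI[of "keys s" "\<lambda>v. v @ a"]
    by (simp add: inj_on_def vimage_def in_keys_iff)
  then obtain t where t: "lookup t = (\<lambda>v. lookup s (v @ a))"
    using Abs_poly_mapping_inverse by fastforce
  show ?thesis
  proof
    show "t \<in> Sym"
    proof (rule SymI)
      fix x i j y assume "(j :: 'n) < i"
      from SymD[OF assms this, of x "y @ a"]
      show "lookup t (x @ [j, i] @ y) = b i j * lookup t (x @ [i, j] @ y)"
        by (simp only: t append_assoc)
    qed
    show "pairing (w * mon a) s = pairing w t" for w
    proof -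
      have "pairing (w * mon a) s = pairing (\<Sum>u\<in>keys w. Poly_Mapping.single (u @ a) (lookup w u)) s"
        by (subst tensor_expand[of w]) (simp add: sum_distrib_right mult_single plus_list_def)
      then show ?thesis by (simp add: pairing_sum_left pairing_single_left pairing_eq[of w] t)
    qed
  qed
qed

definition annihilator :: "'n tensor set" where
  "annihilator = {w. \<forall>s\<in>Sym. pairing w s = 0}"

lemma subspace_annihilator: "tens.subspace annihilator"
  by (auto simp: tens.subspace_def annihilator_def pairing_zero pairing_add_left pairing_scal_left)

lemma two_sided_ideal_annihilator: "two_sided_ideal annihilator"
proof (rule two_sided_idealI[OF subspace_annihilator])
  fix a u assume u: "u \<in> annihilator"
  show "mon a * u \<in> annihilator"
    unfolding annihilator_def
  proof clarify
    fix s assume "s \<in> Sym"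
    then obtain t where "t \<in> Sym" "\<And>w. pairing (mon a * w) s = pairing w t"
      using Sym_contract_left by blast
    then show "pairing (mon a * u) s = 0" using u by (simp add: annihilator_def)
  qed
  show "u * mon a \<in> annihilator"
    unfolding annihilator_def
  proof clarify
    fix s assume "s \<in> Sym"
    then obtain t where "t \<in> Sym" "\<And>w. pairing (w * mon a) s = pairing w t"
      using Sym_contract_right by blast
    then show "pairing (u * mon a) s = 0" using u by (simp add: annihilator_def)
  qed
qed

text \<open>An element of degree 2 sees only the degree-2 part of \<open>s\<close>, which is
  symmetric and thus its own image under \<open>P_qsym\<close>.\<close>

lemma ideal_I_Rt_annihilator: "ideal_gen (I_Rt b p ex) \<subseteq> annihilator"
proof (rule ideal_gen_minimal[OF two_sided_ideal_annihilator], rule subsetI)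
  fix w assume w: "w \<in> I_Rt b p ex"
  have "pairing w s = 0" if s: "s \<in> Sym" for s
  proof -
    have "pairing w s = pairing w (hom_part 2 s)"
      using w by (auto simp: pairing_eq lookup_hom_part I_Rt_def Tdeg_def)
    also have "\<dots> = pairing w (P_qsym b p ex (hom_part 2 s))"
      by (simp only: P_qsym_of_Sym[OF hom_part_Sym[OF s]])
    also have "\<dots> = 0" using w hom_part_Tdeg by (auto simp: I_Rt_def)
    finally show ?thesis .
  qed
  then show "w \<in> annihilator" by (simp add: annihilator_def)
qed

text \<open>Resolves \<open>THE\<close>: all representatives give the same value, and both classes
  are inhabited, so no other value qualifies.\<close>

lemma F_br_qclass:
  "F_br b p ex w (qclass (I_R b p) z) = pairing w (P_qsym b p ex z)"
proof -
  have "F_tens b p ex w' z' = pairing w (P_qsym b p ex z)"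
    if "w' \<in> dual_class b p ex w" "z' \<in> qclass (I_R b p) z" for w' z'
  proof -
    have "w' - w \<in> annihilator"
      using that(1) ideal_I_Rt_annihilator by (auto simp: dual_class_def qclass_def)
    then have "pairing (w' - w) (P_qsym b p ex z) = 0"
      using P_qsym_Sym by (simp add: annihilator_def)
    moreover have "P_qsym b p ex z' = P_qsym b p ex z"
      using that(2) by (intro P_qsym_class) (simp add: qclass_def)
    ultimately show ?thesis
      using pairing_add_left[of "w' - w" w "P_qsym b p ex z"] by (simp add: F_tens_def)
  qed
  moreover have "w \<in> dual_class b p ex w" "z \<in> qclass (I_R b p) z"
    using two_sided_ideal_ideal_gen[of "I_Rt b p ex"] two_sided_ideal_I_R
    by (simp_all add: dual_class_def qclass_def two_sided_ideal_def)
  ultimately have "(THE c. \<forall>w'\<in>dual_class b p ex w. \<forall>z'\<in>qclass (I_R b p) z.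
      F_tens b p ex w' z' = c) = pairing w (P_qsym b p ex z)"
    by (intro the_equality) (blast, metis)
  then show ?thesis
    by (simp add: F_br_def F_fun_def A_alg_def quot_def)
qed

text \<open>\<open>P_qsym\<close> maps onto \<open>Sym\<close>, so equality of the functions tests
  the pairing with all of \<open>Sym\<close>.\<close>

lemma F_br_eq_iff: "F_br b p ex w = F_br b p ex w' \<longleftrightarrow> w - w' \<in> annihilator"
proof -
  have diff: "pairing (w - w') s = pairing w s - pairing w' s" for s
    using pairing_add_left[of "w - w'" w' s] by simp
  show ?thesis
  proof
    assume eq: "F_br b p ex w = F_br b p ex w'"
    have "pairing w s = pairing w' s" if "s \<in> Sym" for s
      using fun_cong[OF eq, of "qclass (I_R b p) s"] P_qsym_of_Sym[OF that]
      by (simp add: F_br_qclass)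
    then show "w - w' \<in> annihilator" by (simp add: annihilator_def diff)
  next
    assume "w - w' \<in> annihilator"
    then have eq: "pairing w (P_qsym b p ex z) = pairing w' (P_qsym b p ex z)" for z
      using P_qsym_Sym[of z] by (simp add: annihilator_def diff)
    show "F_br b p ex w = F_br b p ex w'"
    proof
      fix Z
      show "F_br b p ex w Z = F_br b p ex w' Z"
      proof (cases "Z \<in> A_alg b p")
        case True
        then show ?thesis by (auto simp: A_alg_def quot_def F_br_qclass eq)
      \<comment> \<open>Outside the quotient algebra both restricted functions take the same default
        value.\<close>
      qed (simp add: F_br_def F_fun_def)
    qed
  qed
qed

text \<open>The difference of the products telescopes to
  \<open>(w1 - w1') * w2 + w1' * (w2 - w2')\<close>, with both summands in the annihilator because
  it is an ideal.\<close>

lemma F_br_mult_cong: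
  assumes "F_br b p ex w1 = F_br b p ex w1'" "F_br b p ex w2 = F_br b p ex w2'"
  shows "F_br b p ex (w1 * w2) = F_br b p ex (w1' * w2')"
proof -
  have "(w1 - w1') * w2 \<in> annihilator" "w1' * (w2 - w2') \<in> annihilator"
    using assms two_sided_ideal_annihilator unfolding F_br_eq_iff two_sided_ideal_def by simp_all
  then have "(w1 - w1') * w2 + w1' * (w2 - w2') \<in> annihilator"
    by (rule tens.subspace_add[OF subspace_annihilator])
  then show ?thesis unfolding F_br_eq_iff by (simp add: left_diff_distrib right_diff_distrib)
qed

text \<open>Independence of representatives is the uniqueness that \<open>THE\<close>
  requires.\<close>

lemma F_star_F_br: "F_star b p ex (F_br b p ex w1) (F_br b p ex w2) = F_br b p ex (w1 * w2)"
  unfolding F_star_def by (rule the_equality) (auto intro: F_br_mult_cong)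

end

theorem proposition6p5:
  fixes q :: complex
    and \<alpha> :: "'n::{finite,linorder} \<Rightarrow> 'n \<Rightarrow> complex"
    and b :: "'n \<Rightarrow> 'n \<Rightarrow> complex"
    and p :: "'n \<Rightarrow> 'n \<Rightarrow> 'n tensor"
    and ex :: expr_choice
  assumes "q \<noteq> 0"
    and "\<And>i j. j < i \<Longrightarrow> is_cpower q (\<alpha> i j) (b i j)"
    and "\<And>i j. j < i \<Longrightarrow> p i j \<in> tens.span {mon [a, c] | a c. a < i \<and> c < i}"
    and "EA b p"
    and "\<And>n \<sigma>. \<sigma> permutes {1..n} \<Longrightarrow> is_expression n \<sigma> (ex n \<sigma>)"
  shows "(\<forall>w1 w1' w2 w2'. F_br b p ex w1 = F_br b p ex w1' \<and> F_br b p ex w2 = F_br b p ex w2'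
            \<longrightarrow> F_br b p ex (w1 * w2) = F_br b p ex (w1' * w2'))
    \<and> (\<forall>w1 w2. F_star b p ex (F_br b p ex w1) (F_br b p ex w2) = F_br b p ex (w1 * w2))
    \<and> (\<forall>f \<in> F_space b p ex. \<forall>g \<in> F_space b p ex. F_star b p ex f g \<in> F_space b p ex)
    \<and> (\<forall>f \<in> F_space b p ex. \<forall>g \<in> F_space b p ex. \<forall>h \<in> F_space b p ex.
         F_star b p ex (F_star b p ex f g) h = F_star b p ex f (F_star b p ex g h))"
proof -
  have "quadratic_expressions b p ex"
  proof
    \<comment> \<open>Values of a complex power are exponentials, hence nonzero.\<close>
    show "b i j \<noteq> 0" if "j < i" for i j
      using assms(2)[OF that] by (auto simp: is_cpower_def)
    show "keys (p i j) \<subseteq> {[a, c] | a c. a < i \<and> c < i}" if "j < i" for i j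
    proof -
      let ?S = "{[a, c] | a c. a < i \<and> c < i}"
      have "tens.subspace {u. keys u \<subseteq> ?S}"
      proof (rule tens.subspaceI; clarify)
        fix u v w assume "keys u \<subseteq> ?S" "keys v \<subseteq> ?S" "w \<in> keys (u + v)"
        then have "w \<in> ?S" using Poly_Mapping.keys_add[of u v] by blast
        then show "\<exists>a c. w = [a, c] \<and> a < i \<and> c < i" by simp
      next
        fix k u w assume "keys u \<subseteq> ?S" "w \<in> keys (scal k u)"
        then have "w \<in> ?S" by (auto simp: in_keys_iff lookup_scal)
        then show "\<exists>a c. w = [a, c] \<and> a < i \<and> c < i" by simp
      qed simp
      then have "tens.span {mon [a, c] | a c. a < i \<and> c < i} \<subseteq> {u. keys u \<subseteq> ?S}"
        by (rule tens.span_minimal[rotated]) auto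
      then show ?thesis using assms(3)[OF that] by blast
    qed
  qed (fact assms)+
  then interpret quadratic_expressions b p ex .
  show ?thesis
  proof (intro conjI allI ballI impI)
    show "F_br b p ex (w1 * w2) = F_br b p ex (w1' * w2')"
      if "F_br b p ex w1 = F_br b p ex w1' \<and> F_br b p ex w2 = F_br b p ex w2'" for w1 w1' w2 w2'
      using that by (intro F_br_mult_cong) simp_all
  \<comment> \<open>Associativity is inherited from the tensor product.\<close>
  qed (auto simp: F_space_def F_star_F_br mult.assoc)
qed

end
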